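(* A function $Q=Q(z,w)$ which is holomorphic on $\mathbb{D}^2$ is of the form $\mathcal{Q}[\boldsymbol{\Gamma}_\varphi](z,w)$ for a normalized univalent function $\varphi:\mathbb{D}\to\mathbb{C}$ if and only if (a) $Q(0,w)\equiv0$ and $Q(z,0)\equiv0$, and (b) $Q=Q(z,w)$ solves the nonlinear wave equation \[ \partial_z\partial_w Q+(\partial_z Q)(\partial_w Q)-\frac{z^2\,\partial_z Q-w^2\,\partial_w Q}{zw(z-w)}=0. \]
   Context: $\mathbb{D}=\{z\in\mathbb{C}:|z|<1\}$; $dA=\frac1\pi\,dx\,dy$ is normalized area measure; $L^2(\mathbb{D})$ is the complex $L^2$ space with respect to $dA$, with $\langle f,g\rangle_{\mathbb{D}}=\int_{\mathbb{D}}f\,\bar g\,dA$. A univalent function is an injective holomorphic function; $\varphi:\mathbb{D}\to\mathbb{C}$ is normalized if $\varphi(0)=0$ and $\varphi'(0)=1$. For a univalent function $\varphi:\mathbb{D}\to\mathbb{C}$, the Grunsky operator $\boldsymbol{\Gamma}_\varphi$ is \[ \boldsymbol{\Gamma}_\varphi f(z)=\int_{\mathbb{D}}\bigg(\frac{\varphi'(z)\varphi'(w)}{(\varphi(z)-\varphi(w))^2}-\frac{1}{(z-w)^2}\bigg)f(w)\,dA(w),\qquad z\in\mathbb{D}, \] which is well known to be a norm contraction on $L^2(\mathbb{D})$. For $z\in\mathbb{D}$, $\mathrm{s}_z(\zeta)=\frac{1}{1-\bar z\zeta}$, and $\bar{\mathrm{s}}_z$ is the function $\zeta\mapsto\overline{\mathrm{s}_z(\zeta)}$.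 For a bounded operator $\mathbf{T}$ on $L^2(\mathbb{D})$, $\mathcal{Q}[\mathbf{T}](z,w):=zw\,\langle\mathbf{T}\,\bar{\mathrm{s}}_z,\mathrm{s}_w\rangle_{\mathbb{D}}$ for $z,w\in\mathbb{D}$. For $\mathbf{T}=\boldsymbol{\Gamma}_\varphi$ with $\varphi$ normalized univalent, this is \[ \mathcal{Q}[\boldsymbol{\Gamma}_\varphi](z,w)=\log\frac{zw(\varphi(z)-\varphi(w))}{(z-w)\varphi(z)\varphi(w)},\qquad (z,w)\in\mathbb{D}^2, \] (removable singularities removed, with the branch of the logarithm that vanishes when $z=0$ or $w=0$). The operators $\partial_z,\partial_w$ are the complex derivatives in the respective variables, and the equation in (b) is understood at points of $\mathbb{D}^2$ where $zw(z-w)\ne0$ (the quotient term being extended holomorphically elsewhere). *)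

theory Defs
  imports "HOL-Complex_Analysis.Complex_Analysis"
begin

abbreviation unit_disc :: "complex set"
  where "unit_disc \<equiv> ball 0 1"

definition normalized_univalent :: "(complex \<Rightarrow> complex) \<Rightarrow> bool" where
  "normalized_univalent \<phi> \<longleftrightarrow>
     \<phi> holomorphic_on unit_disc \<and> inj_on \<phi> unit_disc \<and> \<phi> 0 = 0 \<and> deriv \<phi> 0 = 1"

definition disc_integral :: "(complex \<Rightarrow> complex) \<Rightarrow> complex" where
  "disc_integral f = (1 / of_real pi) * integral\<^sup>L (lebesgue_on unit_disc) f"

text \<open>Elements of the space of square-integrable functions on the disc are represented by
  functions on \<^typ>\<open>complex\<close>, of which only the values in the disc matter.\<close>

definition disc_inner :: "(complex \<Rightarrow> complex) \<Rightarrow> (complex \<Rightarrow> complex) \<Rightarrow> complex" where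
  "disc_inner f g = disc_integral (\<lambda>\<zeta>. f \<zeta> * cnj (g \<zeta>))"

text \<open>The kernel has a removable singularity at \<open>w = z\<close>. There the formula below takes the
  junk value \<open>0\<close>, which does not affect the integral since a point is a null set.\<close>

definition grunsky :: "(complex \<Rightarrow> complex) \<Rightarrow> (complex \<Rightarrow> complex) \<Rightarrow> complex \<Rightarrow> complex" where
  "grunsky \<phi> f z =
     disc_integral (\<lambda>w. (deriv \<phi> z * deriv \<phi> w / (\<phi> z - \<phi> w)\<^sup>2 - 1 / (z - w)\<^sup>2) * f w)"

definition szego :: "complex \<Rightarrow> complex \<Rightarrow> complex" where
  "szego z \<zeta> = 1 / (1 - cnj z * \<zeta>)"

definition Q_transform ::
    "((complex \<Rightarrow> complex) \<Rightarrow> complex \<Rightarrow> complex) \<Rightarrow> complex \<Rightarrow> complex \<Rightarrow> complex" where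
  "Q_transform T z w = z * w * disc_inner (T (\<lambda>\<zeta>. cnj (szego z \<zeta>))) (szego w)"

text \<open>Holomorphy in two variables: total differentiability with a complex-linear derivative.\<close>

definition holomorphic2_on ::
    "(complex \<Rightarrow> complex \<Rightarrow> complex) \<Rightarrow> (complex \<times> complex) set \<Rightarrow> bool" where
  "holomorphic2_on F S \<longleftrightarrow>
     (\<forall>p\<in>S. \<exists>a b. ((\<lambda>(z, w). F z w) has_derivative (\<lambda>(h, k). a * h + b * k)) (at p within S))"

definition deriv_fst :: "(complex \<Rightarrow> complex \<Rightarrow> complex) \<Rightarrow> complex \<Rightarrow> complex \<Rightarrow> complex" where
  "deriv_fst F z w = deriv (\<lambda>u. F u w) z"

definition deriv_snd :: "(complex \<Rightarrow> complex \<Rightarrow> complex) \<Rightarrow> complex \<Rightarrow> complex \<Rightarrow> complex" where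
  "deriv_snd F z w = deriv (\<lambda>v. F z v) w"

end

(*
If \<phi> is univalent, the reproducing formula z <F', s_z> = F z - F 0 (polar coordinates and the
Cauchy formula on circles) evaluates both integrals in Q[\<Gamma>_\<phi>] and gives
  exp Q = z w (\<phi> z - \<phi> w) / ((z - w) \<phi> z \<phi> w);
absolute convergence holds because a bounded univalent image has finite area. Logarithmic
differentiation then yields the wave equation.

Conversely, the wave equation is linear in exp Q, and says that U = (1/w - 1/z) exp Q satisfies
\<partial>_z \<partial>_w U = 0. As U vanishes on the diagonal, U(z,w) = \<psi> w - \<psi> z, so \<phi> = 1 / (\<psi> + c) has the
required exp Q. Since exp Q has no zeros, \<psi> is injective, and by Liouville it omits a value, so c
can be chosen to make \<phi> free of poles.
*)
theory Submission
  imports Defs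
begin

text \<open>With \<psi> = 1 / \<phi> the formula for exp Q reads (\<psi> w - \<psi> z) / (1 / w - 1
  / z), which is the origin of the factor in U. Adding a constant c to \<psi> leaves the formula
  unchanged and replaces \<phi> by \<phi> / (1 + c \<phi>); this freedom is what allows the poles to
  be moved away. The obstacle in the direct half is integrability, since \<phi> may be unbounded
  with an image of infinite area. The reproducing formula is therefore applied to primitives whose
  singularities are removable. Near these points continuity suffices; away from them the derivatives
  are controlled by those of inversions 1 / (\<phi> x - \<phi>), which are square-integrable and
  hence integrable on a bounded set. Identities for exp Q are kept with cleared denominators, so
  that they hold on the whole bidisc. The branch of the logarithm is settled by its value 0 at w =
  0.\<close>

unbundle no fps_syntax


subsection \<open>Area and polar coordinates in the complex plane\<close>

text \<open>The change of variables theorem of the library is stated for \<open>real^'n\<close> only.\<close>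

lemma distr_lborel_Complex_cart:
  "distr lborel borel (\<lambda>x::real^2. Complex (x$1) (x$2)) = (lborel :: complex measure)"
proof (rule lborel_eqI[symmetric])
  have meas: "(\<lambda>x::real^2. Complex (x$1) (x$2)) \<in> borel_measurable borel"
    by (intro borel_measurable_continuous_onI) (auto simp: Complex_eq intro!: continuous_intros)
  fix l u :: complex
  assume lu: "\<And>b. b \<in> Basis \<Longrightarrow> l \<bullet> b \<le> u \<bullet> b"
  have eq: "(\<lambda>x::real^2. Complex (x$1) (x$2)) -` box l u =
      box (vector [Re l, Im l]) (vector [Re u, Im u])"
    by (auto simp: mem_box_cart forall_2 in_box_complex_iff)
  have "l \<bullet> 1 \<le> u \<bullet> 1" "l \<bullet> \<i> \<le> u \<bullet> \<i>"
    using lu[of 1] lu[of \<i>] by (auto simp: Basis_complex_def)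
  hence le: "(vector [Re l, Im l] :: real^2) $ i \<le> vector [Re u, Im u] $ i" for i
    using exhaust_2[of i] by auto
  have le: "\<forall>b\<in>Basis. (vector [Re l, Im l] :: real^2) \<bullet> b \<le> vector [Re u, Im u] \<bullet> b"
  proof
    fix b :: "real^2" assume "b \<in> Basis"
    then obtain i where "b = axis i 1" by (auto simp: Basis_vec_def)
    thus "(vector [Re l, Im l] :: real^2) \<bullet> b \<le> vector [Re u, Im u] \<bullet> b"
      using le[of i] by (simp add: inner_axis)
  qed
  have "emeasure (distr lborel borel (\<lambda>x::real^2. Complex (x$1) (x$2))) (box l u) =
     ennreal (\<Prod>b\<in>Basis. (vector [Re u, Im u] - vector [Re l, Im l] :: real^2) \<bullet> b)"
    using meas le by (simp add: emeasure_distr eq emeasure_lborel_box_eq)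
  also have "(\<Prod>b\<in>Basis. (vector [Re u, Im u] - vector [Re l, Im l] :: real^2) \<bullet> b) =
     (\<Prod>i\<in>UNIV. (vector [Re u, Im u] - vector [Re l, Im l] :: real^2) $ i)"
    by (subst Basis_vec_def, subst prod.UNION_disjoint)
       (auto simp: inner_axis axis_eq_axis)
  also have "\<dots> = (\<Prod>b\<in>Basis. (u - l) \<bullet> b)"
    by (simp add: UNIV_2 Basis_complex_def)
  finally show "emeasure (distr lborel borel (\<lambda>x::real^2. Complex (x$1) (x$2))) (box l u) =
      ennreal (\<Prod>b\<in>Basis. (u - l) \<bullet> b)" .
qed simp

text \<open>Opens area integrals over \<open>complex\<close> to Fubini's theorem.\<close>

lemma distr_lborel_Complex_prod:
  "distr lborel borel (\<lambda>(x, y). Complex x y) = (lborel :: complex measure)"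
proof (rule lborel_eqI[symmetric])
  have meas: "(\<lambda>(x, y). Complex x y) \<in> borel_measurable borel"
    by (intro borel_measurable_continuous_onI) (auto simp: Complex_eq case_prod_unfold intro!: continuous_intros)
  fix l u :: complex
  assume lu: "\<And>b. b \<in> Basis \<Longrightarrow> l \<bullet> b \<le> u \<bullet> b"
  have le: "Re l \<le> Re u" "Im l \<le> Im u"
    using lu[of 1] lu[of \<i>] by (auto simp: Basis_complex_def)
  have eq: "(\<lambda>(x, y). Complex x y) -` box l u = box (Re l) (Re u) \<times> box (Im l) (Im u)"
    by (auto simp: in_box_complex_iff)
  have "emeasure (distr lborel borel (\<lambda>(x, y). Complex x y)) (box l u) =
     emeasure (lborel \<Otimes>\<^sub>M lborel) (box (Re l) (Re u) \<times> box (Im l) (Im u))"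
    using meas by (simp add: emeasure_distr eq lborel_prod)
  also have "\<dots> = ennreal (\<Prod>b\<in>Basis. (u - l) \<bullet> b)"
    using le by (simp add: lborel.emeasure_pair_measure_Times Basis_complex_def ennreal_mult)
  finally show "emeasure (distr lborel borel (\<lambda>(x, y). Complex x y)) (box l u) =
      ennreal (\<Prod>b\<in>Basis. (u - l) \<bullet> b)" .
qed simp

text \<open>\<open>J\<close> is the absolute Jacobian determinant, read off from the images of the
  basis 1, \<i>. Both sides may be infinite, so finiteness of the area of the image can be passed to
  the integral.\<close>

lemma emeasure_complex_image:
  fixes g :: "complex \<Rightarrow> complex"
  assumes S: "S \<in> sets borel" and gS: "g ` S \<in> sets borel"
    and der: "\<And>x. x \<in> S \<Longrightarrow> (g has_derivative g' x) (at x within S)"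
    and inj: "inj_on g S"
    and J: "\<And>x. x \<in> S \<Longrightarrow> \<bar>Re (g' x 1) * Im (g' x \<i>) - Im (g' x 1) * Re (g' x \<i>)\<bar> = J x"
    and Jm: "(\<lambda>x. indicator S x * J x) \<in> borel_measurable borel"
  shows "emeasure lborel (g ` S) = (\<integral>\<^sup>+x. ennreal (indicator S x * J x) \<partial>lborel)"
proof -
  define c where "c = (\<lambda>x::real^2. Complex (x$1) (x$2))"
  define d where "d = (\<lambda>z. vector [Re z, Im z] :: real^2)"
  have cd[simp]: "c (d z) = z" and dc[simp]: "d (c x) = x" for z x
    by (auto simp: c_def d_def vec_eq_iff forall_2)
  have blc: "bounded_linear c"
    unfolding c_def linear_conv_bounded_linear[symmetric]
    by (rule linearI) (auto simp: complex_eq_iff)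
  have bld: "bounded_linear d"
    unfolding d_def linear_conv_bounded_linear[symmetric]
    by (rule linearI) (auto simp: vec_eq_iff forall_2)
  have cm[measurable]: "c \<in> borel_measurable borel"
    by (intro borel_measurable_continuous_onI linear_continuous_on blc)
  have distr: "distr lborel borel c = lborel"
    unfolding c_def by (rule distr_lborel_Complex_cart)
  have im: "d ` T = c -` T" for T
  proof safe
    fix x assume "c x \<in> T" thus "x \<in> d ` T" by (intro image_eqI[of _ _ "c x"]) auto
  qed auto
  define G where "G = d \<circ> g \<circ> c"
  define G' where "G' = (\<lambda>x. d \<circ> g' (c x) \<circ> c)"
  have GS: "G ` (c -` S) = c -` (g ` S)"
    unfolding G_def im[symmetric] by (auto simp: image_comp o_def)
  have S': "c -` S \<in> sets borel" and gS': "c -` (g ` S) \<in> sets borel"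
    using measurable_sets[OF cm S] measurable_sets[OF cm gS] by auto
  have derG: "(G has_derivative G' x) (at x within c -` S)" if "x \<in> c -` S" for x
  proof -
    have 1: "(c has_derivative c) (at x within c -` S)"
      by (rule bounded_linear_imp_has_derivative[OF blc])
    have 2: "(g has_derivative g' (c x)) (at (c x) within c ` (c -` S))"
      using der[of "c x"] that by (rule_tac has_derivative_subset[of _ _ _ S]) auto
    show ?thesis
      using bounded_linear.has_derivative[OF bld diff_chain_within[OF 1 2]]
      by (simp add: G_def G'_def o_def)
  qed
  have injG: "inj_on G (c -` S)"
    using inj unfolding G_def inj_on_def by (metis cd comp_apply dc vimageD)
  have det: "\<bar>det (matrix (G' x))\<bar> = J (c x)" if "x \<in> c -` S" for x
  proof -
    have [simp]: "c (axis 1 1) = 1" "c (axis 2 1) = \<i>"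
      by (auto simp: c_def axis_def complex_eq_iff)
    show ?thesis
      using J[of "c x"] that
      by (simp add: det_2 matrix_def G'_def) (simp add: d_def algebra_simps abs_minus_commute)
  qed
  have hm: "c -` (g ` S) \<in> lmeasurable \<and> measure lebesgue (c -` (g ` S)) = m \<longleftrightarrow>
       ((\<lambda>x. indicator S (c x) * J (c x)) has_integral m) UNIV" for m
  proof -
    have "c -` (g ` S) \<in> lmeasurable \<and> measure lebesgue (c -` (g ` S)) = m \<longleftrightarrow>
       ((\<lambda>x. \<bar>det (matrix (G' x))\<bar>) has_integral m) (c -` S)"
      using has_measure_differentiable_image[OF _ derG injG] S' GS by auto
    also have "\<dots> \<longleftrightarrow> ((\<lambda>x. J (c x)) has_integral m) (c -` S)"
      using det by (intro has_integral_cong) auto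
    also have "\<dots> \<longleftrightarrow> ((\<lambda>x. if x \<in> c -` S then J (c x) else 0) has_integral m) UNIV"
      by (rule has_integral_restrict_UNIV[symmetric])
    also have "(\<lambda>x. if x \<in> c -` S then J (c x) else 0) = (\<lambda>x. indicator S (c x) * J (c x))"
      by (auto simp: indicator_def)
    finally show ?thesis .
  qed
  have em: "emeasure lborel (g ` S) = emeasure lborel (c -` (g ` S))"
    by (subst distr[symmetric]) (use gS in \<open>simp add: emeasure_distr\<close>)
  have nn: "(\<integral>\<^sup>+x. ennreal (indicator S x * J x) \<partial>lborel) =
      (\<integral>\<^sup>+x. ennreal (indicator S (c x) * J (c x)) \<partial>lborel)"
    by (subst distr[symmetric]) (use Jm in \<open>simp add: nn_integral_distr\<close>)
  have mJ: "(\<lambda>x. indicator S (c x) * J (c x)) \<in> borel_measurable borel"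
    using measurable_compose[OF cm Jm] .
  have pos: "indicator S x * J x \<ge> 0" for x
    using J[of x] by (auto simp: indicator_def)
  show ?thesis
  proof (cases "c -` (g ` S) \<in> lmeasurable")
    case True
    define m where "m = measure lebesgue (c -` (g ` S))"
    have "((\<lambda>x. indicator S (c x) * J (c x)) has_integral m) UNIV"
      using hm[of m] True m_def by auto
    from nn_integral_has_integral_lborel[OF mJ pos this]
    have "(\<integral>\<^sup>+x. ennreal (indicator S x * J x) \<partial>lborel) = ennreal m" using nn by simp
    moreover have "emeasure lborel (c -` (g ` S)) = ennreal m"
      using emeasure_eq_measure2[OF True] gS' by (simp add: m_def)
    ultimately show ?thesis using em by simp
  next
    \<comment> \<open>The equivalence \<open>hm\<close> also decides the infinite case: a finite
      integral would make the image a set of finite measure.\<close>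
    case False
    have "\<not> emeasure lebesgue (c -` (g ` S)) < \<infinity>"
      using False gS' by (simp add: fmeasurable_def)
    hence "emeasure lborel (c -` (g ` S)) = \<infinity>"
      using gS' by (simp add: less_top[symmetric])
    moreover have "(\<integral>\<^sup>+x. ennreal (indicator S (c x) * J (c x)) \<partial>lborel) = \<infinity>"
    proof (rule ccontr)
      assume fin: "\<not> ?thesis"
      then obtain m where m: "m \<ge> 0" "(\<integral>\<^sup>+x. ennreal (indicator S (c x) * J (c x)) \<partial>lborel) = ennreal m"
        by (cases "\<integral>\<^sup>+x. ennreal (indicator S (c x) * J (c x)) \<partial>lborel") auto
      from nn_integral_has_integral[OF mJ pos m(2,1)] hm[of m] False show False by blast
    qed
    ultimately show ?thesis using em nn by simp
  qed
qed

text \<open>For injective h the integral of |h'|^2 over U is the area of h(U), finite because h(U)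
  is bounded. Integrability of h' itself follows from |h'| \<le> |h'|^2 + 1 and the finite area of
  U.\<close>

lemma integrable_deriv_univalent:
  assumes "open U" "bounded U" and hol: "h holomorphic_on U" and inj: "inj_on h U"
    and bdd: "bounded (h ` U)"
  shows "set_integrable lborel U (deriv h)"
proof -
  have cont: "continuous_on U (deriv h)"
    using hol \<open>open U\<close> by (intro holomorphic_on_imp_continuous_on holomorphic_deriv)
  have Um[measurable]: "U \<in> sets borel" using \<open>open U\<close> by simp
  have gm: "(\<lambda>x. indicator U x *\<^sub>R deriv h x) \<in> borel_measurable borel"
    using cont by (intro borel_measurable_continuous_on_indicator) auto
  have "(\<lambda>x. (norm (indicator U x *\<^sub>R deriv h x))\<^sup>2) \<in> borel_measurable borel"
    using gm by measurable
  also have "(\<lambda>x. (norm (indicator U x *\<^sub>R deriv h x))\<^sup>2) = (\<lambda>x. indicator U x * (cmod (deriv h x))\<^sup>2)"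
    by (auto simp: indicator_def)
  finally have Jm: "(\<lambda>x. indicator U x * (cmod (deriv h x))\<^sup>2) \<in> borel_measurable borel" .
  have "open (h ` U)"
    using open_mapping_thm3 assms by blast
  have eq: "emeasure lborel (h ` U) = (\<integral>\<^sup>+x. ennreal (indicator U x * (cmod (deriv h x))\<^sup>2) \<partial>lborel)"
  proof (rule emeasure_complex_image)
    show "(h has_derivative (\<lambda>v. deriv h x * v)) (at x within U)" if "x \<in> U" for x
      using holomorphic_derivI[OF hol \<open>open U\<close> that] by (simp add: has_field_derivative_def has_derivative_at_withinI)
    show "\<bar>Re (deriv h x * 1) * Im (deriv h x * \<i>) - Im (deriv h x * 1) * Re (deriv h x * \<i>)\<bar>
        = (cmod (deriv h x))\<^sup>2" for x
      by (simp add: cmod_power2) (simp add: power2_eq_square)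
  qed (use \<open>open (h ` U)\<close> inj Jm in auto)
  have "emeasure lborel (h ` U) < \<infinity>"
    using bdd by (rule emeasure_bounded_finite)
  hence int1: "integrable lborel (\<lambda>x. indicator U x * (cmod (deriv h x))\<^sup>2)"
    using eq Jm by (intro integrableI_bounded) auto
  have "emeasure lborel U < \<infinity>"
    using \<open>bounded U\<close> by (rule emeasure_bounded_finite)
  hence int2: "integrable lborel (indicator U :: complex \<Rightarrow> real)"
    by (intro integrable_real_indicator) auto
  show ?thesis
    unfolding set_integrable_def
  proof (rule Bochner_Integration.integrable_bound[OF Bochner_Integration.integrable_add[OF int1 int2]])
    have "y \<le> y\<^sup>2 + 1" for y :: real
      using zero_le_square[of "y - 1/2"] by (simp add: power2_eq_square algebra_simps)
    thus "AE x in lborel. norm (indicator U x *\<^sub>R deriv h x)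
        \<le> norm (indicator U x * (cmod (deriv h x))\<^sup>2 + indicator U x)"
      by (intro AE_I2) (auto simp: indicator_def abs_of_nonneg add_nonneg_nonneg)
  qed (use gm in simp)
qed

section \<open>Polar coordinates on the disc\<close>

text \<open>Taking the squared radius as coordinate makes the Jacobian the constant pi, so the
  uniform measure on the unit square goes to normalized area without a radial weight.\<close>

lemma distr_polar_unit_disc:
  defines "T \<equiv> \<lambda>z. of_real (sqrt (Re z)) * cis (2 * pi * Im z)"
  shows "distr (density lborel (indicator (box 0 (1 + \<i>)))) borel T =
    density lborel (\<lambda>z. ennreal (1 / pi) * indicator unit_disc z)"
proof (rule measure_eqI)
  fix A assume "A \<in> sets (distr (density lborel (indicator (box 0 (1 + \<i>)))) borel T)"
  hence A[measurable]: "A \<in> sets borel" by simp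
  have Tc: "continuous_on UNIV T"
    unfolding T_def cis_conv_exp by (intro continuous_intros)
  have Tm[measurable]: "T \<in> borel_measurable borel"
    using Tc by (rule borel_measurable_continuous_onI)
  define B where "B = box 0 (1 + \<i>)"
  have Bm[measurable]: "B \<in> sets borel" by (simp add: B_def)
  have inB: "z \<in> B \<longleftrightarrow> 0 < Re z \<and> Re z < 1 \<and> 0 < Im z \<and> Im z < 1" for z
    by (auto simp: B_def in_box_complex_iff)
  define S where "S = T -` A \<inter> B"
  have Sm[measurable]: "S \<in> sets borel"
    using measurable_sets[OF Tm A] by (simp add: S_def)
  have TB: "norm (T z) = sqrt (Re z)" "Arg2pi (T z) = 2 * pi * Im z" if "z \<in> B" for z
  proof -
    show "norm (T z) = sqrt (Re z)" using that by (simp add: T_def norm_mult inB)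
    show "Arg2pi (T z) = 2 * pi * Im z"
      by (rule Arg2pi_unique[where r = "sqrt (Re z)"])
         (use that in \<open>auto simp: T_def inB cis_conv_exp\<close>)
  qed
  have [measurable]: "unit_disc \<in> sets borel" by simp
  \<comment> \<open>Angles strictly between 0 and 2 pi miss the nonnegative real axis. This slit
    lies in the null set \<open>N\<close>, so it does not affect the area.\<close>
  define N where "N = {z. Im z = 0}"
  define D' where "D' = unit_disc - {z. Im z = 0 \<and> Re z \<ge> 0}"
  have D'm[measurable]: "D' \<in> sets borel"
    unfolding D'_def by measurable
  have TS: "T ` S = A \<inter> D'"
  proof (intro equalityI subsetI)
    fix w assume "w \<in> T ` S"
    then obtain z where z: "w = T z" "z \<in> B" "T z \<in> A" by (auto simp: S_def)
    have "norm w < 1" using z TB(1)[of z] by (simp add: inB real_less_lsqrt)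
    moreover have "Arg2pi w \<noteq> 0" using z TB(2)[of z] by (simp add: inB)
    ultimately show "w \<in> A \<inter> D'"
      using z by (auto simp: D'_def Arg2pi_eq_0 complex_is_Real_iff)
  next
    fix w assume w: "w \<in> A \<inter> D'"
    define z where "z = Complex ((norm w)\<^sup>2) (Arg2pi w / (2 * pi))"
    have "Arg2pi w \<noteq> 0" using w by (auto simp: D'_def Arg2pi_eq_0 complex_is_Real_iff)
    hence "Arg2pi w > 0" using Arg2pi_ge_0[of w] by linarith
    moreover have "w \<noteq> 0" using w by (auto simp: D'_def)
    ultimately have "z \<in> B"
      using w Arg2pi_lt_2pi[of w] by (auto simp: inB z_def D'_def power_less_one_iff abs_square_less_1)
    moreover have "T z = w"
      using Arg2pi_eq[of w] by (simp add: T_def z_def cis_conv_exp)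
    ultimately show "w \<in> T ` S" using w by (auto simp: S_def intro!: image_eqI[of _ _ z])
  qed
  have inj: "inj_on T S"
  proof (rule inj_onI)
    fix x y assume "x \<in> S" "y \<in> S" "T x = T y"
    hence xy: "x \<in> B" "y \<in> B" and T: "T x = T y" by (auto simp: S_def)
    have "sqrt (Re x) = sqrt (Re y)" "2 * pi * Im x = 2 * pi * Im y"
      using TB[OF xy(1)] TB[OF xy(2)] unfolding T by simp_all
    thus "x = y" by (simp add: complex_eq_iff)
  qed
  define T' where "T' = (\<lambda>z v. of_real (Re v / (2 * sqrt (Re z))) * cis (2 * pi * Im z)
        + of_real (sqrt (Re z)) * (of_real (2 * pi * Im v) * (\<i> * cis (2 * pi * Im z))))"
  have em: "emeasure lborel (T ` S) = (\<integral>\<^sup>+x. ennreal (indicator S x * pi) \<partial>lborel)"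
  proof (rule emeasure_complex_image)
    show "(T has_derivative T' z) (at z within S)" if "z \<in> S" for z
    proof -
      have "Re z > 0" using that by (simp add: S_def inB)
      hence 1: "((\<lambda>z. complex_of_real (sqrt (Re z))) has_derivative
          (\<lambda>v. of_real (Re v / (2 * sqrt (Re z))))) (at z within S)"
        by (intro has_derivative_of_real) (auto intro!: derivative_eq_intros simp: field_simps)
      have "((\<lambda>z. \<i> * complex_of_real (2 * pi * Im z)) has_derivative
          (\<lambda>v. \<i> * of_real (2 * pi * Im v))) (at z within S)"
        by (intro has_derivative_mult_right has_derivative_of_real has_derivative_Im has_derivative_ident)
      from has_derivative_compose[OF this DERIV_exp[unfolded has_field_derivative_def]]
      have 2: "((\<lambda>z. cis (2 * pi * Im z)) has_derivative
          (\<lambda>v. of_real (2 * pi * Im v) * (\<i> * cis (2 * pi * Im z)))) (at z within S)"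
        by (simp add: cis_conv_exp mult_ac)
      show ?thesis
        unfolding T_def T'_def
        using has_derivative_mult[OF 1 2] by (simp add: algebra_simps)
    qed
    show "\<bar>Re (T' z 1) * Im (T' z \<i>) - Im (T' z 1) * Re (T' z \<i>)\<bar> = pi" if "z \<in> S" for z
    proof -
      have "Re z > 0" using that by (simp add: S_def inB)
      hence *: "sqrt (Re z) \<noteq> 0" by simp
      define a where "a = 2 * pi * Im z"
      have "Re (T' z 1) * Im (T' z \<i>) - Im (T' z 1) * Re (T' z \<i>) =
          pi * (cos a * cos a) + pi * (sin a * sin a)"
        using * unfolding T'_def a_def[symmetric] by (simp add: field_simps)
      also have "\<dots> = pi * ((cos a)\<^sup>2 + (sin a)\<^sup>2)"
        by (simp only: power2_eq_square distrib_left)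
      finally have "Re (T' z 1) * Im (T' z \<i>) - Im (T' z 1) * Re (T' z \<i>) = pi"
        by simp
      thus ?thesis by simp
    qed
  qed (use inj TS in auto)
  have N0: "emeasure lborel N = 0"
  proof -
    have "negligible {x::complex. x \<bullet> \<i> = 0}"
      by (rule negligible_standard_hyperplane) (simp add: Basis_complex_def)
    hence "N \<in> null_sets lebesgue" by (simp add: negligible_iff_null_sets N_def)
    moreover have "N \<in> sets borel" unfolding N_def by measurable
    ultimately show ?thesis by (simp add: null_sets_def)
  qed
  have Nm[measurable]: "N \<in> sets borel" unfolding N_def by measurable
  have "emeasure lborel (A \<inter> D') = emeasure lborel (A \<inter> unit_disc)"
  proof (rule emeasure_eq_AE)
    have "AE x in lborel. x \<notin> N" using N0 by (intro AE_not_in) (auto simp: null_sets_def)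
    thus "AE x in lborel. (x \<in> A \<inter> D') = (x \<in> A \<inter> unit_disc)"
      by eventually_elim (auto simp: D'_def N_def)
  qed auto
  with em TS have eq: "emeasure lborel (A \<inter> unit_disc) = ennreal pi * emeasure lborel S"
    by (simp add: mult.commute ennreal_mult' nn_integral_cmult ennreal_indicator[symmetric] del: ennreal_indicator)
       (simp add: ennreal_indicator nn_integral_multc)
  have "emeasure (distr (density lborel (indicator B)) borel T) A = emeasure lborel S"
  proof -
    have "emeasure (distr (density lborel (indicator B)) borel T) A =
        (\<integral>\<^sup>+x. indicator B x * indicator (T -` A) x \<partial>lborel)"
      using measurable_sets[OF Tm A] by (simp add: emeasure_distr emeasure_density)
    also have "\<dots> = (\<integral>\<^sup>+x. indicator S x \<partial>lborel)"
      by (intro nn_integral_cong) (auto simp: S_def indicator_def)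
    finally show ?thesis by simp
  qed
  also have "\<dots> = ennreal (1 / pi) * emeasure lborel (A \<inter> unit_disc)"
    unfolding eq mult.assoc[symmetric] by (simp add: ennreal_mult[symmetric])
  also have "\<dots> = (\<integral>\<^sup>+x. ennreal (1 / pi) * indicator (A \<inter> unit_disc) x \<partial>lborel)"
    by (subst nn_integral_cmult_indicator) auto
  also have "\<dots> = (\<integral>\<^sup>+x. ennreal (1 / pi) * indicator unit_disc x * indicator A x \<partial>lborel)"
    by (intro nn_integral_cong) (auto simp: indicator_def)
  also have "\<dots> = emeasure (density lborel (\<lambda>z. ennreal (1 / pi) * indicator unit_disc z)) A"
    by (subst emeasure_density) auto
  finally show "emeasure (distr (density lborel (indicator (box 0 (1 + \<i>)))) borel T) A =
     emeasure (density lborel (\<lambda>z. ennreal (1 / pi) * indicator unit_disc z)) A"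
    by (simp add: B_def)
qed simp

lemma integral_indicator_Ioo:
  fixes g :: "real \<Rightarrow> complex"
  assumes "continuous_on {0..1} g" and "(g has_integral I) {0..1}"
  shows "(\<integral>t. indicator {0<..<1} t *\<^sub>R g t \<partial>lborel) = I"
proof -
  have "set_integrable lborel {0<..<1} g"
    using borel_integrable_atLeastAtMost'[OF assms(1)]
    by (rule set_integrable_subset) auto
  from set_borel_integral_eq_integral(2)[OF this] show ?thesis
    using assms(2) by (simp add: set_lebesgue_integral_def has_integral_Icc_iff_Ioo integral_unique)
qed

text \<open>The angular integral is the inner one, so that the Cauchy formula can act on each
  circle. Integrability of f licenses Fubini.\<close>

lemma disc_integral_polar:
  assumes cont: "continuous_on unit_disc f" and int: "set_integrable lborel unit_disc f"
  shows "disc_integral f = (\<integral>s. indicator {0<..<1} s *\<^sub>R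
     (\<integral>t. indicator {0<..<1} t *\<^sub>R f (of_real (sqrt s) * cis (2 * pi * t)) \<partial>lborel) \<partial>lborel)"
proof -
  define T where "T = (\<lambda>z. of_real (sqrt (Re z)) * cis (2 * pi * Im z))"
  have Tm[measurable]: "T \<in> borel_measurable borel"
    unfolding T_def cis_conv_exp by (intro borel_measurable_continuous_onI continuous_intros)
  have cm[measurable]: "(\<lambda>(x, y). Complex x y) \<in> borel_measurable borel"
    by (intro borel_measurable_continuous_onI) (auto simp: Complex_eq case_prod_unfold intro!: continuous_intros)
  have cm'[measurable]: "(\<lambda>p. Complex (fst p) (snd p)) \<in> borel_measurable borel"
    using cm by (simp add: case_prod_unfold)
  define H where "H = (\<lambda>x. indicator unit_disc x *\<^sub>R f x)"
  have Hm[measurable]: "H \<in> borel_measurable borel"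
    unfolding H_def using cont by (intro borel_measurable_continuous_on_indicator) auto
  define B where "B = box 0 (1 + \<i>)"
  have [measurable]: "B \<in> sets borel" by (simp add: B_def)
  define M where "M = density lborel (\<lambda>x. ennreal (indicator B x))"
  define N where "N = density lborel (\<lambda>z. ennreal (1 / pi * indicator unit_disc z))"
  have "(\<lambda>x. ennreal (indicator B x)) = indicator B"
    "(\<lambda>z. ennreal (1 / pi * indicator unit_disc z)) = (\<lambda>z. ennreal (1 / pi) * indicator unit_disc z)"
    by (auto simp: indicator_def fun_eq_iff)
  hence distr: "distr M borel T = N"
    using distr_polar_unit_disc by (simp only: M_def N_def T_def B_def)
  have H2: "(1 / pi * indicator unit_disc x) *\<^sub>R H x = (1 / pi) *\<^sub>R H x" for x
    by (auto simp: H_def indicator_def)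
  have iH: "integrable lborel H" using int by (simp add: H_def set_integrable_def)
  have "unit_disc \<in> sets borel" by simp
  hence mN: "(\<lambda>z. 1 / pi * indicator unit_disc z) \<in> borel_measurable lborel"
    by (intro borel_measurable_times borel_measurable_const) (simp add: borel_measurable_indicator)
  have iN: "integrable N H"
    unfolding N_def using iH by (subst integrable_density) (simp_all only: H2 mN, simp_all)
  define K where "K = (\<lambda>(s, t). indicator B (Complex s t) *\<^sub>R H (T (Complex s t)))"
  have "disc_integral f = (1 / pi) * integral\<^sup>L lborel H"
    unfolding disc_integral_def using Hm
    by (subst integral_restrict_space) (auto simp: integral_completion H_def)
  also have "\<dots> = integral\<^sup>L N H"
    unfolding N_def by (subst integral_density) (simp_all only: H2 mN, simp_all add: scaleR_conv_of_real)
  also have "\<dots> = (\<integral>x. H (T x) \<partial>M)"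
    unfolding distr[symmetric] by (subst integral_distr) (auto simp: M_def)
  also have "\<dots> = (\<integral>x. indicator B x *\<^sub>R H (T x) \<partial>lborel)"
    unfolding M_def by (subst integral_density) auto
  also have "\<dots> = integral\<^sup>L (lborel \<Otimes>\<^sub>M lborel) K"
    by (subst distr_lborel_Complex_prod[symmetric], subst integral_distr)
       (auto simp: K_def lborel_prod case_prod_unfold)
  also have "\<dots> = (\<integral>s. (\<integral>t. K (s, t) \<partial>lborel) \<partial>lborel)"
  proof (rule lborel_pair.integral_fst'[symmetric])
    have "integrable M (\<lambda>x. H (T x))"
      using iN unfolding distr[symmetric] by (subst (asm) integrable_distr_eq) (auto simp: M_def)
    hence "integrable lborel (\<lambda>x. indicator B x *\<^sub>R H (T x))"
      unfolding M_def by (subst (asm) integrable_density) auto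
    thus "integrable (lborel \<Otimes>\<^sub>M lborel) K"
      by (subst (asm) distr_lborel_Complex_prod[symmetric], subst (asm) integrable_distr_eq)
         (auto simp: K_def lborel_prod case_prod_unfold)
  qed
  also have "\<dots> = (\<integral>s. indicator {0<..<1} s *\<^sub>R
     (\<integral>t. indicator {0<..<1} t *\<^sub>R f (of_real (sqrt s) * cis (2 * pi * t)) \<partial>lborel) \<partial>lborel)"
  proof (intro Bochner_Integration.integral_cong refl)
    fix s :: real
    have "K (s, t) = indicator {0<..<1} s *\<^sub>R (indicator {0<..<1} t *\<^sub>R f (of_real (sqrt s) * cis (2 * pi * t)))" for t
      by (auto simp: K_def H_def B_def T_def in_box_complex_iff indicator_def norm_mult real_less_lsqrt)
    thus "(\<integral>t. K (s, t) \<partial>lborel) = indicator {0<..<1} s *\<^sub>R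
     (\<integral>t. indicator {0<..<1} t *\<^sub>R f (of_real (sqrt s) * cis (2 * pi * t)) \<partial>lborel)"
      by (simp del: scaleR_scaleR)
  qed
  finally show ?thesis .
qed

subsection \<open>The reproducing formula\<close>

text \<open>In polar coordinates with \<open>s = |\<zeta>|\<^sup>2\<close>, the Cauchy formula on the circle turns the
  angular integral into the value of the derivative at \<open>s z\<close>.\<close>

lemma disc_integral_deriv_szego:
  assumes F: "F holomorphic_on unit_disc" and int: "set_integrable lborel unit_disc (deriv F)"
    and z: "z \<in> unit_disc"
  shows "z * disc_integral (\<lambda>\<zeta>. deriv F \<zeta> * cnj (szego z \<zeta>)) = F z - F 0"
proof -
  define f where "f = deriv F"
  have hf: "f holomorphic_on unit_disc"
    unfolding f_def using F by (intro holomorphic_deriv) auto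
  have cf: "continuous_on unit_disc f" using hf by (rule holomorphic_on_imp_continuous_on)
  have nz: "1 - z * cnj \<zeta> \<noteq> 0" if "norm \<zeta> \<le> 1" for \<zeta>
  proof
    assume "1 - z * cnj \<zeta> = 0"
    hence "norm z * norm \<zeta> = 1" by (metis complex_mod_cnj eq_iff_diff_eq_0 norm_mult norm_one)
    moreover have "norm z * norm \<zeta> \<le> norm z" using that by (simp add: mult_left_le)
    ultimately show False using z by simp
  qed
  define G where "G = (\<lambda>\<zeta>. f \<zeta> * cnj (szego z \<zeta>))"
  have Gz: "G \<zeta> = f \<zeta> / (1 - z * cnj \<zeta>)" for \<zeta>
    by (simp add: G_def szego_def)
  have cG: "continuous_on unit_disc G"
    unfolding Gz[abs_def] using nz by (intro continuous_intros cf) auto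
  \<comment> \<open>On the disc |1 - z cnj \<zeta>| \<ge> 1 - |z|, so the kernel costs only this
    constant factor.\<close>
  have "set_integrable lborel unit_disc (\<lambda>\<zeta>. of_real (1 / (1 - norm z)) * f \<zeta>)"
    using int by (simp add: f_def)
  hence iG: "set_integrable lborel unit_disc G"
  proof (rule set_integrable_bound)
    show "set_borel_measurable lborel unit_disc G"
      unfolding set_borel_measurable_def using borel_measurable_continuous_on_indicator[OF _ cG] by simp
    have "norm (G x) \<le> norm (of_real (1 / (1 - norm z)) * f x)" if "x \<in> unit_disc" for x
    proof -
      have "1 - norm z \<le> 1 - norm (z * cnj x)"
        using that by (simp add: norm_mult mult_left_le)
      also have "\<dots> \<le> norm (1 - z * cnj x)" using norm_triangle_ineq2[of 1 "z * cnj x"] by simp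
      finally have "1 / norm (1 - z * cnj x) \<le> 1 / (1 - norm z)"
        using z by (intro divide_left_mono mult_pos_pos) auto
      hence "norm (f x) * (1 / norm (1 - z * cnj x)) \<le> norm (f x) * (1 / (1 - norm z))"
        by (rule mult_left_mono) simp
      moreover have "norm (complex_of_real (1 / (1 - norm z))) = 1 / (1 - norm z)"
        using z by (simp only: norm_of_real) simp
      ultimately show ?thesis by (simp only: Gz norm_divide norm_mult) simp
    qed
    thus "AE x in lborel. x \<in> unit_disc \<longrightarrow> norm (G x) \<le> norm (of_real (1 / (1 - norm z)) * f x)"
      by simp
  qed
  have inner: "(\<integral>t. indicator {0<..<1} t *\<^sub>R G (of_real (sqrt s) * cis (2 * pi * t)) \<partial>lborel) = f (of_real s * z)"
    if s: "0 < s" "s < 1" for s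
  proof (rule integral_indicator_Ioo)
    define r where "r = complex_of_real (sqrt s)"
    have r: "norm r < 1" "r * r = of_real s" using s by (auto simp: r_def simp flip: of_real_mult)
    have rd: "r * u \<in> unit_disc" if "norm u \<le> 1" for u
    proof -
      have "norm r * norm u \<le> norm r" using that by (simp add: mult_left_le)
      thus ?thesis using r by (simp add: norm_mult)
    qed
    have "continuous_on {0..1} (\<lambda>t. G (r * cis (2 * pi * t)))"
    proof (rule continuous_on_compose2[OF cG])
      show "continuous_on {0..1} (\<lambda>t. r * cis (2 * pi * t))"
        unfolding cis_conv_exp by (intro continuous_intros)
    qed (use rd in auto)
    thus "continuous_on {0..1} (\<lambda>t. G (complex_of_real (sqrt s) * cis (2 * pi * t)))"
      by (simp add: r_def)
    \<comment> \<open>For \<zeta> = r u with |u| = 1 the conjugate of u is 1 / u, hence 1 / (1 - z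
      cnj \<zeta>) = u / (u - z r). This is a Cauchy kernel with pole z r, and there f (r u) becomes
      f (s z).\<close>
    have "((\<lambda>u. f (r * u) / (u - z * r)) has_contour_integral (2 * of_real pi * \<i> * f (r * (z * r)))) (circlepath 0 1)"
    proof (rule Cauchy_integral_circlepath)
      show "continuous_on (cball 0 1) (\<lambda>u. f (r * u))"
        by (rule continuous_on_compose2[OF cf]) (use rd in \<open>auto intro!: continuous_intros\<close>)
      show "(\<lambda>u. f (r * u)) holomorphic_on ball 0 1"
        using rd by (intro holomorphic_on_compose_gen[OF _ hf, unfolded o_def] holomorphic_intros) auto
      show "cmod (z * r - 0) < 1" using rd[of z] z by (simp add: mult.commute)
    qed
    hence "((\<lambda>t. f (r * cis (2 * pi * t)) / (cis (2 * pi * t) - z * r) * (2 * pi * \<i> * cis (2 * pi * t)))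
        has_integral (2 * of_real pi * \<i> * f (r * (z * r)))) {0..1}"
      unfolding has_contour_integral_def
      by (rule has_integral_eq[rotated], simp add: vector_derivative_circlepath01)
         (simp add: circlepath cis_conv_exp mult_ac)
    hence "((\<lambda>t. (1 / (2 * pi * \<i>)) * (f (r * cis (2 * pi * t)) / (cis (2 * pi * t) - z * r) * (2 * pi * \<i> * cis (2 * pi * t))))
        has_integral (1 / (2 * pi * \<i>)) * (2 * of_real pi * \<i> * f (r * (z * r)))) {0..1}"
      by (rule has_integral_mult_right)
    moreover have "(1 / (2 * pi * \<i>)) * (f (r * cis (2 * pi * t)) / (cis (2 * pi * t) - z * r) * (2 * pi * \<i> * cis (2 * pi * t)))
       = G (r * cis (2 * pi * t))" for t
    proof -
      define u where "u = cis (2 * pi * t)"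
      have u: "norm u = 1" by (simp add: u_def)
      hence u0: "u \<noteq> 0" by auto
      have uc: "u * cnj u = 1" using u by (simp add: complex_norm_square[symmetric])
      have cr: "cnj r = r" by (simp add: r_def)
      have "u - z * r = u * (1 - z * cnj (r * u))"
        using uc by (simp add: algebra_simps cr)
      hence "u / (u - z * r) = 1 / (1 - z * cnj (r * u))" using u0 by simp
      hence "f (r * u) / (u - z * r) * u = G (r * u)"
        unfolding Gz by (metis (no_types, lifting) mult.commute mult.right_neutral times_divide_eq_left times_divide_eq_right)
      thus ?thesis unfolding u_def[symmetric] by (simp add: field_simps)
    qed
    moreover have "r * (z * r) = of_real s * z" using r(2) by (simp add: mult_ac)
    moreover have "1 / (complex_of_real (2 * pi) * \<i>) * (2 * complex_of_real pi * \<i> * c) = c" for c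
      by simp
    ultimately show "((\<lambda>t. G (complex_of_real (sqrt s) * cis (2 * pi * t))) has_integral f (of_real s * z)) {0..1}"
      unfolding r_def[symmetric] by (simp only:)
  qed
  have "disc_integral G = (\<integral>s. indicator {0<..<1} s *\<^sub>R f (of_real s * z) \<partial>lborel)"
    unfolding disc_integral_polar[OF cG iG]
  proof (intro Bochner_Integration.integral_cong refl)
    fix s :: real
    show "indicator {0<..<1} s *\<^sub>R
        (\<integral>t. indicator {0<..<1} t *\<^sub>R G (of_real (sqrt s) * cis (2 * pi * t)) \<partial>lborel) =
      indicator {0<..<1} s *\<^sub>R f (of_real s * z)"
      using inner[of s] by (cases "s \<in> {0<..<1}") simp_all
  qed
  \<comment> \<open>The radial integrand is now the derivative of F (s z) in s, so the fundamental
    theorem finishes.\<close>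
  hence "z * disc_integral G = (\<integral>s. indicator {0<..<1} s *\<^sub>R (z * f (of_real s * z)) \<partial>lborel)"
    by (simp flip: integral_mult_right_zero)
  also have "\<dots> = F (of_real 1 * z) - F (of_real 0 * z)"
  proof (rule integral_indicator_Ioo)
    have sz: "of_real s * z \<in> unit_disc" if "s \<in> {0..1}" for s
    proof -
      have "\<bar>s\<bar> * norm z \<le> norm z" using that by (simp add: mult_left_le_one_le)
      thus ?thesis using z by (simp add: norm_mult)
    qed
    show "continuous_on {0..1} (\<lambda>s. z * f (of_real s * z))"
      by (intro continuous_intros continuous_on_compose2[OF cf]) (use sz in auto)
    show "((\<lambda>s. z * f (of_real s * z)) has_integral F (of_real 1 * z) - F (of_real 0 * z)) {0..1}"
    proof (rule fundamental_theorem_of_calculus)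
      fix s :: real assume s: "s \<in> {0..1}"
      have "(F has_field_derivative f (of_real s * z)) (at (of_real s * z))"
        unfolding f_def using sz[OF s] by (intro holomorphic_derivI[OF F]) auto
      moreover have "((\<lambda>u. u * z) has_field_derivative z) (at (of_real s))"
        by (auto intro!: derivative_eq_intros)
      ultimately have "((\<lambda>u. F (u * z)) has_field_derivative (f (of_real s * z) * z)) (at (of_real s))"
        by (intro DERIV_chain2[where g = "\<lambda>u. u * z"])
      from has_vector_derivative_real_field[OF this]
      show "((\<lambda>s. F (of_real s * z)) has_vector_derivative z * f (of_real s * z)) (at s within {0..1})"
        by (simp add: mult.commute o_def)
    qed auto
  qed
  finally show ?thesis by (simp add: G_def f_def)
qed

subsection \<open>The Grunsky operator of a univalent function\<close>

text \<open>For functions continuous across a removable singularity whose natural estimate breaks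
  down there: a compact disc around the point is cut out, and on it continuity suffices.\<close>

lemma set_integrable_Diff_compact:
  fixes f :: "complex \<Rightarrow> complex"
  assumes "continuous_on D f" "compact C" "C \<subseteq> D" "D \<in> sets borel" "set_integrable lborel (D - C) f"
  shows "set_integrable lborel D f"
proof -
  have "set_integrable lborel C f"
    unfolding set_integrable_def
    by (rule borel_integrable_compact[OF assms(2) continuous_on_subset[OF assms(1,3)]])
  hence "set_integrable lborel (C \<union> (D - C)) f"
    using assms borel_closed[OF compact_imp_closed[OF \<open>compact C\<close>]] by (intro set_integrable_Un) auto
  also have "C \<union> (D - C) = D" using assms by auto
  finally show ?thesis .
qed

lemma set_integrable_bounded_continuous:
  fixes f :: "complex \<Rightarrow> complex"
  assumes "continuous_on U f" "open U" "bounded U" "\<And>x. x \<in> U \<Longrightarrow> norm (f x) \<le> B"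
  shows "set_integrable lborel U f"
proof (rule set_integrable_bound)
  have "emeasure lborel U < \<infinity>"
    using \<open>bounded U\<close> by (rule emeasure_bounded_finite)
  thus "set_integrable lborel U (\<lambda>_. complex_of_real B)"
    unfolding set_integrable_def using \<open>open U\<close> by (intro integrable_indicator) auto
  show "set_borel_measurable lborel U f"
    unfolding set_borel_measurable_def
    using borel_measurable_continuous_on_indicator[of U f] assms by simp
  have "norm (f x) \<le> norm (complex_of_real B)" if "x \<in> U" for x
    using assms(4)[OF that] by simp
  thus "AE x in lborel. x \<in> U \<longrightarrow> norm (f x) \<le> norm (complex_of_real B)" by simp
qed

section \<open>Difference quotients and inversions of univalent functions\<close>

definition diff_quot :: "(complex \<Rightarrow> complex) \<Rightarrow> complex \<Rightarrow> complex \<Rightarrow> complex" where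
  "diff_quot f a z = (if z = a then deriv f a else (f z - f a) / (z - a))"

lemma holomorphic_diff_quot:
  "f holomorphic_on S \<Longrightarrow> open S \<Longrightarrow> diff_quot f a holomorphic_on S"
  unfolding diff_quot_def[abs_def] by (rule pole_lemma_open)

text \<open>At z = a this is the nonvanishing of the derivative of a univalent function. It permits
  division by the quotient and, later, a holomorphic logarithm.\<close>

lemma diff_quot_nonzero:
  assumes "f holomorphic_on S" "open S" "inj_on f S" "a \<in> S" "z \<in> S"
  shows "diff_quot f a z \<noteq> 0"
proof (cases "z = a")
  case True
  thus ?thesis using assms holomorphic_injective_imp_regular[of f S a] by (simp add: diff_quot_def)
next
  case False
  thus ?thesis using assms inj_onD[of f S z a] by (auto simp: diff_quot_def)
qed

text \<open>By the open mapping theorem the image of a small disc about x contains a disc about f x,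
  and injectivity keeps the values at all other points out of it.\<close>

lemma univalent_bounded_away:
  assumes hol: "f holomorphic_on S" and S: "open S" and inj: "inj_on f S" and x: "x \<in> S" and "r > 0"
  obtains e where "e > 0" "\<And>\<zeta>. \<zeta> \<in> S - cball x r \<Longrightarrow> e \<le> norm (f \<zeta> - f x)"
proof -
  have "open (f ` (S \<inter> ball x r))"
    using hol S inj by (intro open_mapping_thm3) (auto intro: holomorphic_on_subset inj_on_subset)
  moreover have "f x \<in> f ` (S \<inter> ball x r)" using x \<open>r > 0\<close> by auto
  ultimately obtain e where e: "e > 0" "ball (f x) e \<subseteq> f ` (S \<inter> ball x r)"
    using open_contains_ball by metis
  have "e \<le> norm (f \<zeta> - f x)" if "\<zeta> \<in> S - cball x r" for \<zeta>
  proof (rule ccontr)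
    assume "\<not> ?thesis"
    hence "f \<zeta> \<in> f ` (S \<inter> ball x r)" using e by (auto simp: dist_norm norm_minus_commute)
    then obtain y where "y \<in> S" "y \<in> ball x r" "f \<zeta> = f y" by auto
    thus False using that inj_onD[OF inj, of \<zeta> y] by auto
  qed
  with e that show ?thesis by blast
qed

text \<open>The inverted function \<open>1 / (f x - f)\<close> is again univalent, and bounded away from \<open>x\<close>,
  so its image has finite area.\<close>

lemma set_integrable_deriv_over_square:
  assumes hol: "f holomorphic_on unit_disc" and inj: "inj_on f unit_disc" and x: "x \<in> unit_disc" and "r > 0"
  shows "set_integrable lborel (unit_disc - cball x r) (\<lambda>\<zeta>. deriv f \<zeta> / (f \<zeta> - f x)\<^sup>2)"
proof -
  define U where "U = unit_disc - cball x r"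
  define h where "h = (\<lambda>\<zeta>. 1 / (f x - f \<zeta>))"
  have U: "open U" "bounded U" "U \<subseteq> unit_disc"
    by (auto simp: U_def intro: bounded_subset[of unit_disc])
  have nz: "f x - f \<zeta> \<noteq> 0" if "\<zeta> \<in> U" for \<zeta>
    using inj_onD[OF inj, of x \<zeta>] that x \<open>r > 0\<close> by (auto simp: U_def)
  have holU: "f holomorphic_on U" using hol U holomorphic_on_subset by blast
  obtain e where e: "e > 0" "\<And>\<zeta>. \<zeta> \<in> U \<Longrightarrow> e \<le> norm (f \<zeta> - f x)"
    using univalent_bounded_away[OF hol _ inj x \<open>r > 0\<close>] unfolding U_def by blast
  have "set_integrable lborel U (deriv h)"
  proof (rule integrable_deriv_univalent)
    show "h holomorphic_on U" unfolding h_def using nz by (intro holomorphic_intros holU) auto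
    show "inj_on h U"
    proof (rule inj_onI)
      fix a b assume ab: "a \<in> U" "b \<in> U" "h a = h b"
      hence "f a = f b" using nz[of a] nz[of b] by (auto simp: h_def)
      thus "a = b" using ab U inj_onD[OF inj] by blast
    qed
    have "norm (h \<zeta>) \<le> 1 / e" if "\<zeta> \<in> U" for \<zeta>
      using e(2)[OF that] e(1) by (simp add: h_def norm_divide norm_minus_commute frac_le)
    thus "bounded (h ` U)" by (auto simp: bounded_iff)
  qed (use U in auto)
  moreover have "deriv h \<zeta> = deriv f \<zeta> / (f \<zeta> - f x)\<^sup>2" if "\<zeta> \<in> U" for \<zeta>
  proof (rule DERIV_imp_deriv)
    have "(f has_field_derivative deriv f \<zeta>) (at \<zeta>)"
      using holomorphic_derivI[OF holU \<open>open U\<close> that] .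
    thus "(h has_field_derivative deriv f \<zeta> / (f \<zeta> - f x)\<^sup>2) (at \<zeta>)"
      unfolding h_def using nz[OF that]
      by (auto intro!: derivative_eq_intros simp: power2_eq_square) (simp add: field_simps)
  qed
  ultimately show ?thesis
    unfolding U_def[symmetric] using set_integrable_cong by (metis (no_types, lifting))
qed

text \<open>Serves to ignore the junk values that division by zero gives at the poles of the
  kernels.\<close>

lemma disc_integral_cong_finite:
  assumes "finite X" "\<And>\<zeta>. \<zeta> \<in> unit_disc - X \<Longrightarrow> f \<zeta> = g \<zeta>"
  shows "disc_integral f = disc_integral g"
proof -
  have "integral\<^sup>L (lebesgue_on unit_disc) f = integral\<^sup>L (lebesgue_on unit_disc) g"
  proof (rule integral_discrete_difference[where X = "X \<inter> unit_disc"])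
    show "emeasure (lebesgue_on unit_disc) {x} = 0" if "x \<in> X \<inter> unit_disc" for x
      using that by (subst emeasure_restrict_space) auto
    show "{x} \<in> sets (lebesgue_on unit_disc)" if "x \<in> X \<inter> unit_disc" for x
      using that by (simp add: sets_restrict_space_iff)
  qed (use assms in \<open>auto intro: countable_finite\<close>)
  thus ?thesis by (simp add: disc_integral_def)
qed

text \<open>The kernel is the derivative in its second variable of \<phi>' x / (\<phi> x - \<phi>
  \<zeta>) - 1 / (x - \<zeta>), so the reproducing formula returns the difference of this primitive
  between z and 0. Both points must differ from x for the primitive to be read off in this
  form.\<close>

lemma grunsky_szego:
  assumes hol: "\<phi> holomorphic_on unit_disc" and inj: "inj_on \<phi> unit_disc"
    and x: "x \<in> unit_disc" and z: "z \<in> unit_disc" "z \<noteq> x" and "x \<noteq> 0"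
  shows "z * grunsky \<phi> (\<lambda>\<zeta>. cnj (szego z \<zeta>)) x =
    deriv \<phi> x / (\<phi> x - \<phi> z) - 1 / (x - z) - deriv \<phi> x / (\<phi> x - \<phi> 0) + 1 / x"
proof -
  define d where "d = diff_quot \<phi> x"
  have hd: "d holomorphic_on unit_disc" unfolding d_def by (intro holomorphic_diff_quot hol) simp
  have d0: "d \<zeta> \<noteq> 0" if "\<zeta> \<in> unit_disc" for \<zeta>
    unfolding d_def using diff_quot_nonzero[OF hol _ inj x that] by simp
  \<comment> \<open>\<open>M\<close> is the primitive of the kernel. Writing it as a difference
    quotient of the difference quotient \<open>d\<close>, divided by \<open>d\<close>, shows that
    the simple poles at x cancel.\<close>
  define M where "M = (\<lambda>\<zeta>. diff_quot d x \<zeta> / d \<zeta>)"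
  have hM: "M holomorphic_on unit_disc"
    unfolding M_def by (intro holomorphic_intros holomorphic_diff_quot hd d0) auto
  have nz: "\<phi> x - \<phi> \<zeta> \<noteq> 0" if "\<zeta> \<in> unit_disc" "\<zeta> \<noteq> x" for \<zeta>
    using inj_onD[OF inj, of x \<zeta>] that x by auto
  have Meq: "M \<zeta> = deriv \<phi> x / (\<phi> x - \<phi> \<zeta>) - 1 / (x - \<zeta>)" if "\<zeta> \<in> unit_disc" "\<zeta> \<noteq> x" for \<zeta>
  proof -
    have "d \<zeta> = (\<phi> x - \<phi> \<zeta>) / (x - \<zeta>)" "d x = deriv \<phi> x" "diff_quot d x \<zeta> = (d x - d \<zeta>) / (x - \<zeta>)"
      using that by (auto simp: d_def diff_quot_def divide_simps) (simp_all add: algebra_simps)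
    moreover have "((D - a / b) / b) / (a / b) = D / a - 1 / b" if "a \<noteq> 0" "b \<noteq> 0" for D a b :: complex
      using that by (simp add: field_simps)
    moreover have "x - \<zeta> \<noteq> 0" using that by simp
    ultimately show ?thesis unfolding M_def using nz[OF that] by simp
  qed
  have dM: "deriv M \<zeta> = deriv \<phi> x * deriv \<phi> \<zeta> / (\<phi> x - \<phi> \<zeta>)\<^sup>2 - 1 / (x - \<zeta>)\<^sup>2"
    if \<zeta>: "\<zeta> \<in> unit_disc - {x}" for \<zeta>
  proof (rule DERIV_imp_deriv)
    have D: "(\<phi> has_field_derivative deriv \<phi> \<zeta>) (at \<zeta>)"
      using \<zeta> by (intro holomorphic_derivI[OF hol]) auto
    have "((\<lambda>\<zeta>. deriv \<phi> x / (\<phi> x - \<phi> \<zeta>) - 1 / (x - \<zeta>)) has_field_derivative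
        deriv \<phi> x * deriv \<phi> \<zeta> / (\<phi> x - \<phi> \<zeta>)\<^sup>2 - 1 / (x - \<zeta>)\<^sup>2) (at \<zeta>)"
      using nz[of \<zeta>] \<zeta> by (auto intro!: derivative_eq_intros D simp: power2_eq_square)
    thus "(M has_field_derivative deriv \<phi> x * deriv \<phi> \<zeta> / (\<phi> x - \<phi> \<zeta>)\<^sup>2 - 1 / (x - \<zeta>)\<^sup>2) (at \<zeta>)"
    proof (rule has_field_derivative_transform_within_open[where S = "unit_disc - {x}"])
      show "open (unit_disc - {x})" by (intro open_Diff) auto
    qed (use \<zeta> Meq in auto)
  qed
  have "open unit_disc" by simp
  then obtain r where r: "r > 0" "cball x r \<subseteq> unit_disc"
    using x open_contains_cball by metis
  have iM: "set_integrable lborel unit_disc (deriv M)"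
  proof (rule set_integrable_Diff_compact)
    show "continuous_on unit_disc (deriv M)"
      using hM by (intro holomorphic_on_imp_continuous_on holomorphic_deriv) auto
    \<comment> \<open>Each of the two terms has a double pole at x; they are integrable separately
      only off a disc about x.\<close>
    have "set_integrable lborel (unit_disc - cball x r) (\<lambda>\<zeta>. deriv \<phi> x * (deriv \<phi> \<zeta> / (\<phi> \<zeta> - \<phi> x)\<^sup>2))"
      by (intro set_integrable_mult_right set_integrable_deriv_over_square[OF hol inj x r(1)])
    moreover have "set_integrable lborel (unit_disc - cball x r) (\<lambda>\<zeta>. 1 / (x - \<zeta>)\<^sup>2)"
    proof (rule set_integrable_bounded_continuous[where B = "1 / r\<^sup>2"])
      show "continuous_on (unit_disc - cball x r) (\<lambda>\<zeta>. 1 / (x - \<zeta>)\<^sup>2)"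
        using r(1) by (intro continuous_intros) auto
      fix \<zeta> assume "\<zeta> \<in> unit_disc - cball x r"
      hence "r \<le> norm (x - \<zeta>)" by (simp add: dist_norm)
      hence "r\<^sup>2 \<le> (norm (x - \<zeta>))\<^sup>2" using r(1) by (intro power_mono) auto
      thus "norm (1 / (x - \<zeta>)\<^sup>2) \<le> 1 / r\<^sup>2"
        using r(1) by (simp add: norm_divide norm_power frac_le)
    qed (auto intro: bounded_subset[of unit_disc])
    ultimately have "set_integrable lborel (unit_disc - cball x r)
       (\<lambda>\<zeta>. deriv \<phi> x * (deriv \<phi> \<zeta> / (\<phi> \<zeta> - \<phi> x)\<^sup>2) - 1 / (x - \<zeta>)\<^sup>2)"
      by (rule set_integral_diff)
    moreover have "deriv \<phi> x * (deriv \<phi> \<zeta> / (\<phi> \<zeta> - \<phi> x)\<^sup>2) - 1 / (x - \<zeta>)\<^sup>2 = deriv M \<zeta>"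
      if "\<zeta> \<in> unit_disc - cball x r" for \<zeta>
    proof -
      have "\<zeta> \<noteq> x" using that r(1) by auto
      thus ?thesis using dM[of \<zeta>] that by (simp add: power2_commute)
    qed
    ultimately show "set_integrable lborel (unit_disc - cball x r) (deriv M)"
      using set_integrable_cong by (metis (no_types, lifting))
  qed (use r in auto)
  have "z * grunsky \<phi> (\<lambda>\<zeta>. cnj (szego z \<zeta>)) x = z * disc_integral (\<lambda>\<zeta>. deriv M \<zeta> * cnj (szego z \<zeta>))"
    unfolding grunsky_def
    by (intro arg_cong[of _ _ "(*) z"] disc_integral_cong_finite[of "{x}"]) (auto simp: dM)
  also have "\<dots> = M z - M 0"
    using hM iM z(1) by (rule disc_integral_deriv_szego)
  also have "\<dots> = deriv \<phi> x / (\<phi> x - \<phi> z) - 1 / (x - z) - deriv \<phi> x / (\<phi> x - \<phi> 0) + 1 / x"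
    using Meq[of z] Meq[of 0] z \<open>x \<noteq> 0\<close> by simp
  finally show ?thesis .
qed

lemma deriv_log_quotient:
  assumes hol: "\<phi> holomorphic_on unit_disc" and q: "q holomorphic_on unit_disc"
    and rel: "\<And>\<zeta>. \<zeta> \<in> unit_disc \<Longrightarrow> exp (q \<zeta>) * ((\<zeta> - a) * \<phi> \<zeta> * \<phi> a) = \<zeta> * a * (\<phi> \<zeta> - \<phi> a)"
    and \<zeta>: "\<zeta> \<in> unit_disc" "\<zeta> \<noteq> 0" "\<zeta> \<noteq> a" "\<phi> \<zeta> \<noteq> 0" "\<phi> \<zeta> \<noteq> \<phi> a" "a \<noteq> 0"
  shows "deriv q \<zeta> = deriv \<phi> \<zeta> / (\<phi> \<zeta> - \<phi> a) - 1 / (\<zeta> - a) - deriv \<phi> \<zeta> / \<phi> \<zeta> + 1 / \<zeta>"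
proof -
  have D: "(\<phi> has_field_derivative deriv \<phi> \<zeta>) (at \<zeta>)" "(q has_field_derivative deriv q \<zeta>) (at \<zeta>)"
    using \<zeta> by (auto intro!: holomorphic_derivI[OF hol] holomorphic_derivI[OF q])
  define L where "L = (\<lambda>\<zeta>. \<zeta> * a * (\<phi> \<zeta> - \<phi> a))"
  have "((\<lambda>\<zeta>. exp (q \<zeta>) * ((\<zeta> - a) * \<phi> \<zeta> * \<phi> a)) has_field_derivative
      (exp (q \<zeta>) * ((\<zeta> - a) * \<phi> \<zeta> * \<phi> a)) * (deriv q \<zeta> + 1 / (\<zeta> - a) + deriv \<phi> \<zeta> / \<phi> \<zeta>)) (at \<zeta>)"
    using \<zeta> by (auto intro!: derivative_eq_intros D) (simp add: field_simps)
  hence 1: "(L has_field_derivative L \<zeta> * (deriv q \<zeta> + 1 / (\<zeta> - a) + deriv \<phi> \<zeta> / \<phi> \<zeta>)) (at \<zeta>)"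
    unfolding rel[OF \<zeta>(1)] L_def
    by (rule has_field_derivative_transform_within_open[where S = unit_disc]) (use \<zeta> rel in auto)
  have 2: "(L has_field_derivative L \<zeta> * (1 / \<zeta> + deriv \<phi> \<zeta> / (\<phi> \<zeta> - \<phi> a))) (at \<zeta>)"
    unfolding L_def using \<zeta> by (auto intro!: derivative_eq_intros D) (simp add: field_simps)
  have "L \<zeta> \<noteq> 0" using \<zeta> by (simp add: L_def)
  hence "deriv q \<zeta> + 1 / (\<zeta> - a) + deriv \<phi> \<zeta> / \<phi> \<zeta> = 1 / \<zeta> + deriv \<phi> \<zeta> / (\<phi> \<zeta> - \<phi> a)"
    using DERIV_unique[OF 1 2] by simp
  thus ?thesis by (simp add: algebra_simps)
qed

text \<open>The operator integrates the kernel in one variable and the pairing with \<open>szego w\<close> integrates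
  the result in the other, which turns the double pole into a logarithm.\<close>

lemma Q_transform_grunsky:
  assumes \<phi>: "normalized_univalent \<phi>" and z: "z \<in> unit_disc"
  obtains g where "g holomorphic_on unit_disc" "g 0 = 0"
    "\<And>w. w \<in> unit_disc \<Longrightarrow> Q_transform (grunsky \<phi>) z w = g w"
    "\<And>w. w \<in> unit_disc \<Longrightarrow> exp (g w) * ((z - w) * \<phi> z * \<phi> w) = z * w * (\<phi> z - \<phi> w)"
proof (cases "z = 0")
  case True
  show ?thesis
    by (rule that[of "\<lambda>_. 0"]) (use True \<phi> in \<open>auto simp: Q_transform_def normalized_univalent_def\<close>)
next
  case False
  have hol: "\<phi> holomorphic_on unit_disc" and inj: "inj_on \<phi> unit_disc"
    and \<phi>0: "\<phi> 0 = 0" and d1: "deriv \<phi> 0 = 1"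
    using \<phi> by (auto simp: normalized_univalent_def)
  have D0: "0 \<in> unit_disc" by simp
  have nz0: "\<phi> \<zeta> \<noteq> 0" if "\<zeta> \<in> unit_disc" "\<zeta> \<noteq> 0" for \<zeta>
    using inj_onD[OF inj, of \<zeta> 0] that \<phi>0 by auto
  have nzz: "\<phi> \<zeta> - \<phi> z \<noteq> 0" if "\<zeta> \<in> unit_disc" "\<zeta> \<noteq> z" for \<zeta>
    using inj_onD[OF inj, of \<zeta> z] that z by auto
  define p where "p = diff_quot \<phi> 0"
  define d where "d = diff_quot \<phi> z"
  \<comment> \<open>\<open>H\<close> is the argument of the logarithm with its singularities at 0
    and z filled in. Since \<open>d\<close> takes the value \<phi> z / z at 0 and \<open>p\<close>
    the value \<phi>'(0) = 1, \<open>H\<close> is 1 at 0, which normalizes the branch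
    \<open>g\<close>.\<close>
  define H where "H = (\<lambda>w. z / \<phi> z * (d w / p w))"
  have p0: "p w \<noteq> 0" and dz: "d w \<noteq> 0" if "w \<in> unit_disc" for w
    unfolding p_def d_def
    using diff_quot_nonzero[OF hol _ inj D0 that] diff_quot_nonzero[OF hol _ inj z that] by simp_all
  have hH: "H holomorphic_on unit_disc"
    unfolding H_def p_def d_def
    by (intro holomorphic_intros holomorphic_diff_quot hol) (use p0 in \<open>auto simp: p_def\<close>)
  have H0: "H w \<noteq> 0" if "w \<in> unit_disc" for w
    using p0[OF that] dz[OF that] False nz0[OF z] by (simp add: H_def)
  have "contractible unit_disc" by (intro convex_imp_contractible) simp
  then obtain g0 where g0: "g0 holomorphic_on unit_disc" "\<And>w. w \<in> unit_disc \<Longrightarrow> H w = exp (g0 w)"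
    using contractible_imp_holomorphic_log[OF hH _ H0] by metis
  define g where "g = (\<lambda>w. g0 w - g0 0)"
  have hg: "g holomorphic_on unit_disc" unfolding g_def by (intro holomorphic_intros g0)
  have "H 0 = 1"
    using False \<phi>0 d1 nz0[OF z] by (simp add: H_def d_def p_def diff_quot_def)
  hence "exp (g0 0) = 1" using g0(2)[of 0] by simp
  hence expg: "exp (g w) = H w" if "w \<in> unit_disc" for w
    using g0(2)[OF that] by (simp add: g_def exp_diff)
  have Heq: "H w = z / \<phi> z * ((\<phi> w - \<phi> z) / (w - z) * (w / \<phi> w))" if "w \<noteq> 0" "w \<noteq> z" for w
    using that by (simp add: H_def d_def p_def diff_quot_def \<phi>0 mult_ac)
  have rel: "exp (g w) * ((z - w) * \<phi> z * \<phi> w) = z * w * (\<phi> z - \<phi> w)" if w: "w \<in> unit_disc" for w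
  proof (cases "w = 0 \<or> w = z")
    case True
    thus ?thesis by (auto simp: \<phi>0)
  next
    case wz: False
    have "w - z \<noteq> 0" using wz by simp
    moreover have "z / a * ((b - a) / c * (w / b)) * (- c * a * b) = z * w * (a - b)"
      if "a \<noteq> 0" "b \<noteq> 0" "c \<noteq> 0" for a b c
      using that by (simp add: field_simps)
    ultimately show ?thesis
      unfolding expg[OF w] using wz Heq[of w] nz0[OF z False] nz0[OF w] by (metis minus_diff_eq)
  qed
  have dg: "deriv g w = deriv \<phi> w / (\<phi> w - \<phi> z) - 1 / (w - z) - deriv \<phi> w / \<phi> w + 1 / w"
    if w: "w \<in> unit_disc - {0, z}" for w
  proof (rule deriv_log_quotient[OF hol hg])
    fix \<zeta> assume "\<zeta> \<in> unit_disc"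
    from rel[OF this] show "exp (g \<zeta>) * ((\<zeta> - z) * \<phi> \<zeta> * \<phi> z) = \<zeta> * z * (\<phi> \<zeta> - \<phi> z)"
      by (simp add: algebra_simps)
  qed (use w z False nz0 nzz in auto)
  obtain r0 where r0: "r0 > 0" "cball 0 r0 \<subseteq> unit_disc"
    using D0 open_contains_cball open_ball by metis
  obtain rz where rz: "rz > 0" "cball z rz \<subseteq> unit_disc"
    using z open_contains_cball open_ball by metis
  define V where "V = unit_disc - (cball 0 r0 \<union> cball z rz)"
  have V: "open V" "bounded V" "V \<subseteq> unit_disc - {0, z}"
    using r0 rz by (auto simp: V_def intro: bounded_subset[of unit_disc])
  have ig: "set_integrable lborel unit_disc (deriv g)"
  proof (rule set_integrable_Diff_compact)
    show cg: "continuous_on unit_disc (deriv g)"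
      using hg by (intro holomorphic_on_imp_continuous_on holomorphic_deriv) auto
    have i0: "set_integrable lborel V (\<lambda>\<zeta>. deriv \<phi> \<zeta> / (\<phi> \<zeta> - \<phi> 0)\<^sup>2)"
      by (rule set_integrable_subset[OF set_integrable_deriv_over_square[OF hol inj D0 r0(1)]])
         (use V in \<open>auto simp: V_def\<close>)
    have iz: "set_integrable lborel V (\<lambda>\<zeta>. deriv \<phi> \<zeta> / (\<phi> \<zeta> - \<phi> z)\<^sup>2)"
      by (rule set_integrable_subset[OF set_integrable_deriv_over_square[OF hol inj z rz(1)]])
         (use V in \<open>auto simp: V_def\<close>)
    have ic: "set_integrable lborel V (\<lambda>_. 1 / r0 + 1 / rz)"
      unfolding set_integrable_def using V
      by (intro integrable_indicator emeasure_bounded_finite) auto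
    define bnd where "bnd = (\<lambda>\<zeta>. norm (\<phi> z) * (norm (deriv \<phi> \<zeta> / (\<phi> \<zeta> - \<phi> 0)\<^sup>2)
        + norm (deriv \<phi> \<zeta> / (\<phi> \<zeta> - \<phi> z)\<^sup>2)) + (1 / r0 + 1 / rz))"
    have "set_integrable lborel V bnd"
      unfolding bnd_def
      by (intro set_integral_add(1) set_integrable_mult_right set_integrable_norm i0 iz ic)
    hence "set_integrable lborel V (deriv g)"
    proof (rule set_integrable_bound)
      show "set_borel_measurable lborel V (deriv g)"
        unfolding set_borel_measurable_def
        using borel_measurable_continuous_on_indicator[of V "deriv g"] V continuous_on_subset[OF cg] by auto
      have "norm (deriv g w) \<le> norm (bnd w)" if w: "w \<in> V" for w
      proof -
        have w': "w \<in> unit_disc - {0, z}" using w V by auto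
        have n: "\<phi> w \<noteq> 0" "\<phi> w - \<phi> z \<noteq> 0" using nz0[of w] nzz[of w] w' by auto
        \<comment> \<open>The two fractions in \<phi> combine to a product of 1 / \<phi> w and 1 /
          (\<phi> w - \<phi> z). Then a b \<le> a^2 + b^2 splits it into the two inverted kernels
          \<open>i0\<close> and \<open>iz\<close>, while \<open>V\<close> keeps w away from 0 and z
          for the remaining terms.\<close>
        have "deriv g w = deriv \<phi> w * (\<phi> z / ((\<phi> w - \<phi> z) * \<phi> w)) + (1 / w - 1 / (w - z))"
          using n by (simp add: dg[OF w'] field_simps)
        hence "norm (deriv g w) \<le> norm (deriv \<phi> w * (\<phi> z / ((\<phi> w - \<phi> z) * \<phi> w)))
            + (norm (1 / w) + norm (1 / (w - z)))"
          by (metis add_left_mono norm_triangle_ineq norm_triangle_ineq4 order_trans)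
        also have "norm (deriv \<phi> w * (\<phi> z / ((\<phi> w - \<phi> z) * \<phi> w))) =
            norm (\<phi> z) * (norm (deriv \<phi> w) * ((1 / norm (\<phi> w)) * (1 / norm (\<phi> w - \<phi> z))))"
          by (simp add: norm_mult norm_divide mult_ac)
        also have "\<dots> \<le> norm (\<phi> z) * (norm (deriv \<phi> w) * ((1 / norm (\<phi> w))\<^sup>2 + (1 / norm (\<phi> w - \<phi> z))\<^sup>2))"
        proof (intro mult_left_mono norm_ge_zero)
          fix a b :: real
          have "0 \<le> (a - b)\<^sup>2 + (a\<^sup>2 + b\<^sup>2)" by simp
          thus "a * b \<le> a\<^sup>2 + b\<^sup>2" by (simp add: power2_diff)
        qed
        also have "norm (1 / w) \<le> 1 / r0"
          using w r0 by (simp add: V_def norm_divide frac_le)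
        also have "norm (1 / (w - z)) \<le> 1 / rz"
          using w rz by (simp add: V_def norm_divide frac_le dist_norm norm_minus_commute)
        finally have "norm (deriv g w) \<le> bnd w"
          by (simp add: bnd_def norm_divide norm_power power_divide \<phi>0 algebra_simps)
        thus ?thesis by simp
      qed
      thus "AE w in lborel. w \<in> V \<longrightarrow> norm (deriv g w) \<le> norm (bnd w)" by simp
    qed
    thus "set_integrable lborel (unit_disc - (cball 0 r0 \<union> cball z rz)) (deriv g)"
      by (simp add: V_def)
  qed (use r0 rz in auto)
  have "Q_transform (grunsky \<phi>) z w = g w" if w: "w \<in> unit_disc" for w
  proof -
    have "Q_transform (grunsky \<phi>) z w = w * (z * disc_integral (\<lambda>\<zeta>. grunsky \<phi> (\<lambda>\<zeta>. cnj (szego z \<zeta>)) \<zeta> * cnj (szego w \<zeta>)))"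
      by (simp add: Q_transform_def disc_inner_def)
    also have "\<dots> = w * disc_integral (\<lambda>\<zeta>. z * (grunsky \<phi> (\<lambda>\<zeta>. cnj (szego z \<zeta>)) \<zeta> * cnj (szego w \<zeta>)))"
      by (simp add: disc_integral_def)
    also have "\<dots> = w * disc_integral (\<lambda>\<zeta>. deriv g \<zeta> * cnj (szego w \<zeta>))"
    \<comment> \<open>The formulas for the operator and for \<open>deriv g\<close> agree off 0 and
      z, which is enough under the integral.\<close>
    proof (intro arg_cong[of _ _ "(*) w"] disc_integral_cong_finite[of "{0, z}"])
      fix \<zeta> assume \<zeta>: "\<zeta> \<in> unit_disc - {0, z}"
      have "z * grunsky \<phi> (\<lambda>\<zeta>. cnj (szego z \<zeta>)) \<zeta> = deriv g \<zeta>"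
        using grunsky_szego[OF hol inj _ z, of \<zeta>] \<zeta> by (auto simp: dg \<phi>0)
      thus "z * (grunsky \<phi> (\<lambda>\<zeta>. cnj (szego z \<zeta>)) \<zeta> * cnj (szego w \<zeta>)) = deriv g \<zeta> * cnj (szego w \<zeta>)"
        by (metis mult.assoc)
    qed auto
    also have "\<dots> = g w - g 0"
      using hg ig w by (rule disc_integral_deriv_szego)
    finally show ?thesis by (simp add: g_def)
  qed
  with hg rel show ?thesis by (intro that[of g]) (auto simp: g_def)
qed

subsection \<open>The wave equation\<close>

lemma holomorphic2_on_fst:
  assumes Q: "holomorphic2_on Q (A \<times> B)" and A: "open A" and B: "open B" and w: "w \<in> B"
  shows "(\<lambda>z. Q z w) holomorphic_on A"
  unfolding holomorphic_on_open[OF A]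
proof
  fix z assume z: "z \<in> A"
  have op: "open (A \<times> B)" using A B by (rule open_Times)
  from Q z w obtain a b where
    "((\<lambda>(z, w). Q z w) has_derivative (\<lambda>(h, k). a * h + b * k)) (at (z, w) within A \<times> B)"
    unfolding holomorphic2_on_def by blast
  hence D: "((\<lambda>(z, w). Q z w) has_derivative (\<lambda>(h, k). a * h + b * k)) (at (z, w))"
    using at_within_open[OF _ op, of "(z, w)"] z w by simp
  have "((\<lambda>z. (z, w)) has_derivative (\<lambda>h. (h, 0))) (at z)"
    by (intro has_derivative_Pair has_derivative_ident has_derivative_const)
  from has_derivative_compose[OF this D]
  have "((\<lambda>z. Q z w) has_field_derivative a) (at z)"
    by (simp add: has_field_derivative_def)
  thus "\<exists>f'. ((\<lambda>z. Q z w) has_field_derivative f') (at z)" by blast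
qed

lemma holomorphic2_on_snd:
  assumes Q: "holomorphic2_on Q (A \<times> B)" and A: "open A" and B: "open B" and z: "z \<in> A"
  shows "(\<lambda>w. Q z w) holomorphic_on B"
  unfolding holomorphic_on_open[OF B]
proof
  fix w assume w: "w \<in> B"
  have op: "open (A \<times> B)" using A B by (rule open_Times)
  from Q z w obtain a b where
    "((\<lambda>(z, w). Q z w) has_derivative (\<lambda>(h, k). a * h + b * k)) (at (z, w) within A \<times> B)"
    unfolding holomorphic2_on_def by blast
  hence D: "((\<lambda>(z, w). Q z w) has_derivative (\<lambda>(h, k). a * h + b * k)) (at (z, w))"
    using at_within_open[OF _ op, of "(z, w)"] z w by simp
  have "((\<lambda>w. (z, w)) has_derivative (\<lambda>h. (0, h))) (at w)"
    by (intro has_derivative_Pair has_derivative_ident has_derivative_const)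
  from has_derivative_compose[OF this D]
  have "((\<lambda>w. Q z w) has_field_derivative b) (at w)"
    by (simp add: has_field_derivative_def)
  thus "\<exists>f'. ((\<lambda>w. Q z w) has_field_derivative f') (at w)" by blast
qed

lemma holomorphic2_on_imp_continuous_on:
  assumes "holomorphic2_on Q S"
  shows "continuous_on S (\<lambda>(z, w). Q z w)"
  unfolding continuous_on_eq_continuous_within
proof
  fix p assume "p \<in> S"
  then obtain a b where
    "((\<lambda>(z, w). Q z w) has_derivative (\<lambda>(h, k). a * h + b * k)) (at p within S)"
    using assms unfolding holomorphic2_on_def by blast
  thus "continuous (at p within S) (\<lambda>(z, w). Q z w)" by (rule has_derivative_continuous)
qed

text \<open>Difference quotients in the second variable converge locally uniformly in the first one,
  because the Cauchy estimates bound the second derivative uniformly.\<close>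

lemma holomorphic_deriv_snd:
  assumes Q: "holomorphic2_on Q (A \<times> B)" and A: "open A" and B: "open B" and w: "w \<in> B"
  shows "(\<lambda>z. deriv_snd Q z w) holomorphic_on A"
proof -
  obtain \<rho> where \<rho>: "\<rho> > 0" "cball w \<rho> \<subseteq> B" using w B open_contains_cball by metis
  \<comment> \<open>Half the radius, so that a disc of radius \<open>r\<close> about any point of
    \<open>cball w r\<close> stays in \<open>cball w \<rho>\<close>, where Q is bounded.\<close>
  define r where "r = \<rho> / 2"
  have r: "r > 0" using \<rho> by (simp add: r_def)
  define h where "h = (\<lambda>n. complex_of_real (r / real (Suc n)))"
  have h0: "h n \<noteq> 0" for n using r unfolding h_def of_real_eq_0_iff by simp
  have nh: "norm (h n) = r / real (Suc n)" for n using r unfolding h_def norm_of_real by simp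
  have hr: "norm (h n) \<le> r" for n
    using r by (simp add: nh divide_le_eq mult_le_cancel_left1)
  have hB: "w + h n \<in> B" for n
    using hr[of n] r \<rho> by (intro subsetD[OF \<rho>(2)]) (simp add: dist_norm r_def)
  have hlim: "(\<lambda>n. norm (h n)) \<longlonglongrightarrow> 0"
    unfolding nh using tendsto_mult_left[OF LIMSEQ_inverse_real_of_nat, of r]
    by (simp add: divide_inverse)
  show ?thesis
  proof (rule holomorphic_uniform_sequence[OF A])
    fix n
    show "(\<lambda>z. (Q z (w + h n) - Q z w) / h n) holomorphic_on A"
      by (intro holomorphic_intros holomorphic2_on_fst[OF Q A B] hB w h0)
  next
    fix z0 assume "z0 \<in> A"
    then obtain d where d: "d > 0" "cball z0 d \<subseteq> A" using A open_contains_cball by metis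
    have "compact ((\<lambda>(z, w). Q z w) ` (cball z0 d \<times> cball w \<rho>))"
      using d \<rho> by (intro compact_continuous_image continuous_on_subset[OF holomorphic2_on_imp_continuous_on[OF Q]]
          compact_Times) auto
    hence "bounded ((\<lambda>(z, w). Q z w) ` (cball z0 d \<times> cball w \<rho>))" by (rule compact_imp_bounded)
    then obtain M where "\<forall>x \<in> (\<lambda>(z, w). Q z w) ` (cball z0 d \<times> cball w \<rho>). norm x \<le> M"
      unfolding bounded_iff by blast
    hence M: "norm (Q z v) \<le> M" if "z \<in> cball z0 d" "v \<in> cball w \<rho>" for z v
      using that by blast
    \<comment> \<open>Cauchy's bound for the second derivative on discs of radius \<open>r\<close>;
      it is uniform in z over \<open>cball z0 d\<close>.\<close>
    define C where "C = 2 * M / r\<^sup>2"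
    have est: "norm ((Q z (w + h n) - Q z w) / h n - deriv_snd Q z w) \<le> C * norm (h n)"
      if z: "z \<in> cball z0 d" for z n
    proof -
      have hq: "Q z holomorphic_on B" using holomorphic2_on_snd[OF Q A B, of z] z d by auto
      have sub: "cball v r \<subseteq> cball w \<rho>" if "v \<in> cball w r" for v
      proof
        fix x assume "x \<in> cball v r"
        thus "x \<in> cball w \<rho>" using that dist_triangle[of w x v] by (simp add: r_def)
      qed
      have "cmod ((deriv ^^ 0) (Q z) (w + h n) - (\<Sum>i\<le>1. (deriv ^^ i) (Q z) w * (w + h n - w) ^ i / fact i))
          \<le> C * cmod (w + h n - w) ^ Suc 1 / fact 1"
      proof (rule complex_Taylor[where S = "cball w r"])
        fix i v assume v: "v \<in> cball w r"
        have "v \<in> cball w \<rho>" using v r by (simp add: r_def)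
        hence "v \<in> B" using \<rho> by auto
        hence "((deriv ^^ i) (Q z) has_field_derivative (deriv ^^ Suc i) (Q z) v) (at v)"
          using holomorphic_derivI[OF holomorphic_higher_deriv[OF hq B] B, of v i] by simp
        thus "((deriv ^^ i) (Q z) has_field_derivative (deriv ^^ Suc i) (Q z) v) (at v within cball w r)"
          by (rule has_field_derivative_at_within)
      next
        fix v assume v: "v \<in> cball w r"
        have "norm ((deriv ^^ 2) (Q z) v) \<le> fact 2 * M / r ^ 2"
        proof (rule Cauchy_inequality)
          have "cball v r \<subseteq> B" using sub[OF v] \<rho> by auto
          thus "Q z holomorphic_on ball v r" "continuous_on (cball v r) (Q z)"
            using hq holomorphic_on_subset holomorphic_on_imp_continuous_on ball_subset_cball by (metis order_trans)+
          show "norm (Q z x) \<le> M" if "norm (v - x) = r" for x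
            using sub[OF v] that z by (intro M) (auto simp: dist_norm)
        qed (use r in auto)
        thus "cmod ((deriv ^^ Suc 1) (Q z) v) \<le> C"
          by (simp add: C_def numeral_2_eq_2)
      qed (use r hr[of n] in \<open>auto simp: dist_norm\<close>)
      hence *: "norm (Q z (w + h n) - Q z w - deriv_snd Q z w * h n) \<le> C * norm (h n) ^ 2"
        by (simp add: deriv_snd_def power2_eq_square diff_diff_eq)
      have "(Q z (w + h n) - Q z w) / h n - deriv_snd Q z w = (Q z (w + h n) - Q z w - deriv_snd Q z w * h n) / h n"
        using h0[of n] by (simp add: diff_divide_distrib)
      also have "norm \<dots> \<le> C * norm (h n) ^ 2 / norm (h n)"
        unfolding norm_divide using * by (intro divide_right_mono) auto
      also have "\<dots> = C * norm (h n)" using h0[of n] by (simp add: power2_eq_square)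
      finally show ?thesis .
    qed
    have "uniform_limit (cball z0 d) (\<lambda>n z. (Q z (w + h n) - Q z w) / h n) (\<lambda>z. deriv_snd Q z w) sequentially"
    proof (rule uniform_limitI)
      fix e :: real assume "e > 0"
      have "(\<lambda>n. C * norm (h n)) \<longlonglongrightarrow> C * 0" by (intro tendsto_intros hlim)
      hence "eventually (\<lambda>n. C * norm (h n) < e) sequentially"
        using \<open>e > 0\<close> by (intro order_tendstoD(2)[of _ "C * 0"]) auto
      thus "\<forall>\<^sub>F n in sequentially. \<forall>z\<in>cball z0 d. dist ((Q z (w + h n) - Q z w) / h n) (deriv_snd Q z w) < e"
        unfolding dist_norm by eventually_elim (blast intro: le_less_trans[OF est])
    qed
    thus "\<exists>d>0. cball z0 d \<subseteq> A \<and>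
        uniform_limit (cball z0 d) (\<lambda>n z. (Q z (w + h n) - Q z w) / h n) (\<lambda>z. deriv_snd Q z w) sequentially"
      using d by blast
  qed
qed

section \<open>Consequences of the wave equation\<close>

text \<open>Multiplying \<open>exp Q\<close> by \<open>1 / w - 1 / z\<close> turns the nonlinear equation into \<open>\<partial>\<^sub>z\<partial>\<^sub>w U = 0\<close>, so that
  \<open>U\<close> splits into functions of one variable; it also vanishes on the diagonal.\<close>

lemma wave_equation_imp_split:
  assumes Q: "holomorphic2_on Q (unit_disc \<times> unit_disc)"
    and Q0: "\<And>w. w \<in> unit_disc \<Longrightarrow> Q 0 w = 0" "\<And>z. z \<in> unit_disc \<Longrightarrow> Q z 0 = 0"
    and eq: "\<And>z w. z \<in> unit_disc \<Longrightarrow> w \<in> unit_disc \<Longrightarrow> z * w * (z - w) \<noteq> 0 \<Longrightarrow>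
      deriv_fst (deriv_snd Q) z w + deriv_fst Q z w * deriv_snd Q z w
        - (z\<^sup>2 * deriv_fst Q z w - w\<^sup>2 * deriv_snd Q z w) / (z * w * (z - w)) = 0"
  obtains \<eta> where "\<eta> holomorphic_on unit_disc" "\<eta> 0 = 1"
    "\<And>z w. z \<in> unit_disc \<Longrightarrow> w \<in> unit_disc \<Longrightarrow> (z - w) * exp (Q z w) = z * \<eta> w - w * \<eta> z"
proof -
  define D where "D = unit_disc - {0}"
  have D: "open D" "connected D" "D \<subseteq> unit_disc"
    unfolding D_def by (auto intro!: open_Diff connected_open_delete)
  have hz: "(\<lambda>z. Q z w) holomorphic_on unit_disc" if "w \<in> unit_disc" for w
    using holomorphic2_on_fst[OF Q _ _ that] by simp
  have hw: "(\<lambda>w. Q z w) holomorphic_on unit_disc" if "z \<in> unit_disc" for z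
    using holomorphic2_on_snd[OF Q _ _ that] by simp
  have hr: "(\<lambda>z. deriv_snd Q z w) holomorphic_on unit_disc" if "w \<in> unit_disc" for w
    using holomorphic_deriv_snd[OF Q _ _ that] by simp
  define U where "U = (\<lambda>z w. (1 / w - 1 / z) * exp (Q z w))"
  \<comment> \<open>\<open>b\<close> is the w-derivative of \<open>U\<close>; the aim is that it
    does not depend on z.\<close>
  define b where "b = (\<lambda>z w. exp (Q z w) * ((1 / w - 1 / z) * deriv_snd Q z w - 1 / w\<^sup>2))"
  have dU: "(U z has_field_derivative b z w) (at w)" if "z \<in> D" "w \<in> D" for z w
  proof -
    have "(Q z has_field_derivative deriv_snd Q z w) (at w)"
      unfolding deriv_snd_def using holomorphic_derivI[OF hw[of z], of w] that by (simp add: D_def)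
    thus ?thesis unfolding U_def b_def using that
      by (auto intro!: derivative_eq_intros simp: D_def power2_eq_square) (simp add: algebra_simps)
  qed
  have b_const: "b z1 w = b z2 w" if w: "w \<in> D" and z: "z1 \<in> D" "z2 \<in> D" for z1 z2 w
  proof -
    have wd: "w \<in> unit_disc" "w \<noteq> 0" using w by (auto simp: D_def)
    have "\<exists>c. \<forall>z\<in>D. b z w = c"
    proof (rule DERIV_zero_connected_constant)
      have "(\<lambda>z. b z w) holomorphic_on D"
        unfolding b_def using wd
        by (intro holomorphic_intros holomorphic_on_subset[OF hz] holomorphic_on_subset[OF hr] D) (auto simp: D_def)
      thus "continuous_on D (\<lambda>z. b z w)" by (rule holomorphic_on_imp_continuous_on)
      \<comment> \<open>The equation is only assumed for z \<noteq> w; continuity of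
        \<open>b\<close> covers the one exceptional point.\<close>
      show "\<forall>z\<in>D - {w}. ((\<lambda>z. b z w) has_field_derivative 0) (at z)"
      proof
        fix z assume z: "z \<in> D - {w}"
        have zd: "z \<in> unit_disc" "z \<noteq> 0" "z \<noteq> w" using z by (auto simp: D_def)
        define P where "P = deriv_fst Q z w"
        define R where "R = deriv_snd Q z w"
        define S where "S = deriv_fst (deriv_snd Q) z w"
        have dQ: "((\<lambda>z. Q z w) has_field_derivative P) (at z)"
          unfolding P_def deriv_fst_def using holomorphic_derivI[OF hz[OF wd(1)], of z] zd by simp
        have dR: "((\<lambda>z. deriv_snd Q z w) has_field_derivative S) (at z)"
          unfolding S_def deriv_fst_def using holomorphic_derivI[OF hr[OF wd(1)], of z] zd by simp
        have der: "((\<lambda>z. b z w) has_field_derivative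
            exp (Q z w) * P * ((1 / w - 1 / z) * R - 1 / w\<^sup>2) + exp (Q z w) * (R / z\<^sup>2 + (1 / w - 1 / z) * S)) (at z)"
          unfolding b_def using zd wd
          by (auto intro!: derivative_eq_intros dQ dR simp: power2_eq_square R_def)
        have "S + P * R = (z\<^sup>2 * P - w\<^sup>2 * R) / (z * w * (z - w))"
          using eq[OF zd(1) wd(1)] zd wd unfolding P_def R_def S_def by simp
        \<comment> \<open>Multiplication by 1 / w - 1 / z turns the quotient term into P / w^2 - R /
          z^2, which is what the product rule contributes when this factor is
          differentiated.\<close>
        hence "(z - w) / (z * w) * (S + P * R) = (z\<^sup>2 * P - w\<^sup>2 * R) / (z * w)\<^sup>2"
          using zd wd by (simp add: power2_eq_square)
        also have "\<dots> = P / w\<^sup>2 - R / z\<^sup>2"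
          using zd wd by (simp add: field_simps)
        also have "(z - w) / (z * w) = 1 / w - 1 / z" using zd wd by (simp add: field_simps)
        finally have "P * ((1 / w - 1 / z) * R - 1 / w\<^sup>2) + (R / z\<^sup>2 + (1 / w - 1 / z) * S) = 0"
          by (simp add: algebra_simps)
        hence "exp (Q z w) * P * ((1 / w - 1 / z) * R - 1 / w\<^sup>2) + exp (Q z w) * (R / z\<^sup>2 + (1 / w - 1 / z) * S) = 0"
          by (simp only: mult.assoc distrib_left[symmetric] mult_zero_right)
        with der show "((\<lambda>z. b z w) has_field_derivative 0) (at z)" by simp
      qed
    qed (use D in auto)
    thus ?thesis using z by metis
  qed
  have split: "U z w = U p w - U p z" if z: "z \<in> D" and w: "w \<in> D" and p: "p \<in> D" for z w p
  proof -
    \<comment> \<open>Rows of \<open>U\<close> differ by a constant because they share the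
      w-derivative \<open>b\<close>; evaluating at w = z, where U z z = 0, identifies the
      constant.\<close>
    have "\<exists>c. \<forall>w\<in>D. U z w - U p w = c"
    proof (rule DERIV_zero_connected_constant[of D "{}"])
      have d0: "((\<lambda>w. U z w - U p w) has_field_derivative 0) (at w)" if "w \<in> D" for w
        using DERIV_diff[OF dU[OF z that] dU[OF p that]] b_const[OF that z p] by simp
      thus "\<forall>w\<in>D - {}. ((\<lambda>w. U z w - U p w) has_field_derivative 0) (at w)" by simp
      show "continuous_on D (\<lambda>w. U z w - U p w)"
        using d0 by (meson DERIV_isCont continuous_at_imp_continuous_on)
    qed (use D in auto)
    hence "U z w - U p w = U z z - U p z" using w z by metis
    moreover have "U z z = 0" by (simp add: U_def)
    ultimately show ?thesis by (simp add: algebra_simps)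
  qed
  \<comment> \<open>Any base point of the punctured disc would do: another choice changes the row
    \<open>U p\<close> by a constant.\<close>
  define p where "p = (1 / 2 :: complex)"
  have p: "p \<in> D" "p \<in> unit_disc" "p \<noteq> 0" by (auto simp: p_def D_def)
  \<comment> \<open>This is w * U p w with the pole of \<open>U p\<close> at 0 cancelled, hence
    holomorphic on the whole disc.\<close>
  define \<eta> where "\<eta> = (\<lambda>w. (1 - w / p) * exp (Q p w))"
  show ?thesis
  proof (rule that)
    show "\<eta> holomorphic_on unit_disc"
      unfolding \<eta>_def using p by (intro holomorphic_intros hw) auto
    show \<eta>0: "\<eta> 0 = 1" using Q0(2)[OF p(2)] by (simp add: \<eta>_def)
    have \<eta>U: "\<eta> w = w * U p w" if "w \<noteq> 0" for w
      using that p by (simp add: \<eta>_def U_def field_simps)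
    fix z w assume zw: "z \<in> unit_disc" "w \<in> unit_disc"
    show "(z - w) * exp (Q z w) = z * \<eta> w - w * \<eta> z"
    proof (cases "z = 0 \<or> w = 0")
      case True
      thus ?thesis using zw Q0 \<eta>0 by auto
    next
      case False
      hence "U z w = U p w - U p z" using zw p by (intro split) (auto simp: D_def)
      moreover have "(z - w) * exp (Q z w) = z * w * U z w"
        using False by (simp add: U_def field_simps)
      ultimately have "(z - w) * exp (Q z w) = z * w * (U p w - U p z)" by simp
      thus ?thesis using False by (simp add: \<eta>U algebra_simps)
    qed
  qed
qed

text \<open>Otherwise \<open>\<eta> z / z\<close> would map the punctured disc bijectively onto the plane, and its inverse
  would be a bounded entire function.\<close>

lemma exists_nonvanishing_shift:
  assumes hol: "\<eta> holomorphic_on unit_disc" and \<eta>0: "\<eta> 0 = 1"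
    and inj: "\<And>z w. z \<in> unit_disc \<Longrightarrow> w \<in> unit_disc \<Longrightarrow> z * \<eta> w = w * \<eta> z \<Longrightarrow> z = w"
  shows "\<exists>c. \<forall>z\<in>unit_disc. \<eta> z + c * z \<noteq> 0"
proof (rule ccontr)
  assume "\<not> ?thesis"
  hence ex: "\<exists>z\<in>unit_disc. \<eta> z + c * z = 0" for c by auto
  define D where "D = unit_disc - {0}"
  define \<psi> where "\<psi> = (\<lambda>z. \<eta> z / z)"
  have "open D" unfolding D_def by (intro open_Diff) auto
  have h: "\<psi> holomorphic_on D"
    unfolding \<psi>_def by (intro holomorphic_intros holomorphic_on_subset[OF hol]) (auto simp: D_def)
  have i: "inj_on \<psi> D"
  proof (rule inj_onI)
    fix z w assume "z \<in> D" "w \<in> D" "\<psi> z = \<psi> w"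
    thus "z = w" by (rule_tac inj) (auto simp: D_def \<psi>_def divide_simps mult.commute)
  qed
  have surj: "\<psi> ` D = UNIV"
  proof (intro equalityI subsetI UNIV_I)
    fix c
    obtain z where z: "z \<in> unit_disc" "\<eta> z + - c * z = 0" using ex[of "- c"] by blast
    hence "z \<noteq> 0" using \<eta>0 by auto
    moreover from this have "c = \<psi> z" using z(2) by (simp add: \<psi>_def eq_divide_eq)
    ultimately show "c \<in> \<psi> ` D" using z(1) unfolding D_def by blast
  qed
  obtain g where g: "g holomorphic_on (\<psi> ` D)" "\<And>z. z \<in> D \<Longrightarrow> g (\<psi> z) = z"
    using holomorphic_has_inverse[OF h \<open>open D\<close> i] by metis
  have "range g \<subseteq> D" using g(2) surj by (metis image_iff image_subsetI)
  hence "bounded (range g)" by (auto intro: bounded_subset[of unit_disc] simp: D_def)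
  with g(1) surj have "g constant_on UNIV" by (intro Liouville_theorem) auto
  hence "g (\<psi> (1/2)) = g (\<psi> (1/3))" by (auto simp: constant_on_def)
  thus False using g(2)[of "1/2"] g(2)[of "1/3"] by (simp add: D_def)
qed

text \<open>Equal exponentials force the difference f - g to have derivative 0, so agreement at one
  point selects the branch. \<open>K\<close> collects the points at which the exponential relation
  had been multiplied by zero.\<close>

lemma eq_of_exp_eq:
  assumes S: "open S" "connected S" and hf: "f holomorphic_on S" and hg: "g holomorphic_on S" and "finite K"
    and eq: "\<And>z. z \<in> S - K \<Longrightarrow> exp (f z) = exp (g z)" and a: "a \<in> S" "f a = g a" and z: "z \<in> S"
  shows "f z = g z"
proof -
  have "\<exists>c. \<forall>z\<in>S. f z - g z = c"
  proof (rule DERIV_zero_connected_constant[OF S(2,1) \<open>finite K\<close>])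
    show "continuous_on S (\<lambda>z. f z - g z)"
      by (intro continuous_intros holomorphic_on_imp_continuous_on hf hg)
    show "\<forall>z\<in>S - K. ((\<lambda>z. f z - g z) has_field_derivative 0) (at z)"
    proof
      fix z assume z: "z \<in> S - K"
      have df: "(f has_field_derivative deriv f z) (at z)" and dg: "(g has_field_derivative deriv g z) (at z)"
        using z S by (auto intro!: holomorphic_derivI[OF hf] holomorphic_derivI[OF hg])
      have d: "((\<lambda>z. f z - g z) has_field_derivative (deriv f z - deriv g z)) (at z)"
        by (intro DERIV_diff df dg)
      have "((\<lambda>z. exp (f z - g z)) has_field_derivative exp (f z - g z) * (deriv f z - deriv g z)) (at z)"
        by (auto intro!: derivative_eq_intros df dg)
      moreover have "((\<lambda>z. exp (f z - g z)) has_field_derivative 0) (at z)"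
      proof (rule has_field_derivative_transform_within_open[where f = "\<lambda>_. 1" and S = "S - K"])
        show "open (S - K)" using S \<open>finite K\<close> by (intro open_Diff finite_imp_closed)
      qed (use z eq in \<open>auto simp: exp_diff\<close>)
      ultimately have "deriv f z - deriv g z = 0" using DERIV_unique by fastforce
      with d show "((\<lambda>z. f z - g z) has_field_derivative 0) (at z)" by simp
    qed
  qed auto
  hence "f z - g z = f a - g a" using a z by metis
  thus ?thesis using a by simp
qed

section \<open>From a univalent function to the wave equation\<close>

text \<open>Here a, b stand for \<phi> z, \<phi> w and A, B for the derivatives of \<phi> there. P
  and R are then the first derivatives of Q and the leading bracket is the mixed one, so the wave
  equation is pure algebra.\<close>

lemma wave_equation_identity:
  fixes a b A B z w :: complex
  assumes "a \<noteq> 0" "b \<noteq> 0" "a \<noteq> b" "z \<noteq> 0" "w \<noteq> 0" "z \<noteq> w"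
  defines "P \<equiv> A / (a - b) - 1 / (z - w) - A / a + 1 / z"
    and "R \<equiv> B / (b - a) - 1 / (w - z) - B / b + 1 / w"
  shows "(A * B / (b - a)\<^sup>2 - 1 / (w - z)\<^sup>2) + P * R - (z\<^sup>2 * P - w\<^sup>2 * R) / (z * w * (z - w)) = 0"
proof -
  \<comment> \<open>These abbreviations absorb the partial fractions, for instance \<alpha> = 1 / (a
    - b) - 1 / a and v t = 1 / (z - w) - 1 / z. What remains is a polynomial identity modulo u v =
    1.\<close>
  define t where "t = 1 / (z - w)"
  define \<alpha> where "\<alpha> = b / (a * (a - b))"
  define \<beta> where "\<beta> = a / (b * (a - b))"
  define u where "u = z / w"
  define v where "v = w / z"
  have n: "a - b \<noteq> 0" "b - a \<noteq> 0" "z - w \<noteq> 0" "w - z \<noteq> 0" using assms by auto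
  have P: "P = A * \<alpha> - v * t"
    using assms(1-6) n by (simp add: P_def \<alpha>_def v_def t_def divide_simps) (simp add: algebra_simps)
  have R: "R = u * t - B * \<beta>"
    using assms(1-6) n by (simp add: R_def \<beta>_def u_def t_def divide_simps) (simp add: algebra_simps)
  have uv: "u * v = 1" using assms(1-6) by (simp add: u_def v_def)
  have "A * B / (b - a)\<^sup>2 = A * B * (\<alpha> * \<beta>)"
    unfolding power2_commute[of b a]
    using assms(1-6) n by (simp add: \<alpha>_def \<beta>_def power2_eq_square)
  moreover have "1 / (w - z)\<^sup>2 = t * t"
    unfolding power2_commute[of w z] by (simp add: t_def power2_eq_square)
  moreover have "(z\<^sup>2 * P - w\<^sup>2 * R) / (z * w * (z - w)) = (u * P - v * R) * t"
    using assms(4-6) n by (simp add: u_def v_def t_def divide_simps) (simp add: power2_eq_square algebra_simps)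
  ultimately have "(A * B / (b - a)\<^sup>2 - 1 / (w - z)\<^sup>2) + P * R - (z\<^sup>2 * P - w\<^sup>2 * R) / (z * w * (z - w)) =
     A * B * (\<alpha> * \<beta>) - t * t + (A * \<alpha> - v * t) * (u * t - B * \<beta>) - (u * (A * \<alpha> - v * t) - v * (u * t - B * \<beta>)) * t"
    by (simp add: P R)
  also have "\<dots> = (u * v - 1) * (t * t)" by (simp add: algebra_simps)
  finally show ?thesis using uv by simp
qed

lemma grunsky_imp_wave_equation:
  assumes Q: "holomorphic2_on Q (unit_disc \<times> unit_disc)" and \<phi>: "normalized_univalent \<phi>"
    and QT: "\<And>z w. z \<in> unit_disc \<Longrightarrow> w \<in> unit_disc \<Longrightarrow> Q z w = Q_transform (grunsky \<phi>) z w"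
    and zw: "z \<in> unit_disc" "w \<in> unit_disc" "z * w * (z - w) \<noteq> 0"
  shows "deriv_fst (deriv_snd Q) z w + deriv_fst Q z w * deriv_snd Q z w
        - (z\<^sup>2 * deriv_fst Q z w - w\<^sup>2 * deriv_snd Q z w) / (z * w * (z - w)) = 0"
proof -
  have hol: "\<phi> holomorphic_on unit_disc" and inj: "inj_on \<phi> unit_disc" and \<phi>0: "\<phi> 0 = 0"
    using \<phi> by (auto simp: normalized_univalent_def)
  have n: "z \<noteq> 0" "w \<noteq> 0" "z \<noteq> w" using zw by auto
  have nz0: "\<phi> \<zeta> \<noteq> 0" if "\<zeta> \<in> unit_disc" "\<zeta> \<noteq> 0" for \<zeta>
    using inj_onD[OF inj, of \<zeta> 0] that \<phi>0 by auto
  have nzz: "\<phi> \<zeta> \<noteq> \<phi> a" if "\<zeta> \<in> unit_disc" "a \<in> unit_disc" "\<zeta> \<noteq> a" for \<zeta> a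
    using inj_onD[OF inj, of \<zeta> a] that by auto
  have rel: "exp (Q z w) * ((z - w) * \<phi> z * \<phi> w) = z * w * (\<phi> z - \<phi> w)"
    if "z \<in> unit_disc" "w \<in> unit_disc" for z w
    using Q_transform_grunsky[OF \<phi> that(1)] QT[OF that] that(2) by metis
  have P: "deriv_fst Q z w = deriv \<phi> z / (\<phi> z - \<phi> w) - 1 / (z - w) - deriv \<phi> z / \<phi> z + 1 / z"
    unfolding deriv_fst_def
    using zw n by (intro deriv_log_quotient[OF hol holomorphic2_on_fst[OF Q]] rel nz0 nzz) auto
  \<comment> \<open>Stated for varying z, since the formula is differentiated in z next and so is
    needed on a neighbourhood.\<close>
  have R: "deriv_snd Q z w = deriv \<phi> w / (\<phi> w - \<phi> z) - 1 / (w - z) - deriv \<phi> w / \<phi> w + 1 / w"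
    if "z \<in> unit_disc" "z \<noteq> 0" "z \<noteq> w" for z
    unfolding deriv_snd_def
  proof (rule deriv_log_quotient[OF hol holomorphic2_on_snd[OF Q]])
    fix \<zeta> assume "\<zeta> \<in> unit_disc"
    from rel[OF that(1) this] show "exp (Q z \<zeta>) * ((\<zeta> - z) * \<phi> \<zeta> * \<phi> z) = \<zeta> * z * (\<phi> \<zeta> - \<phi> z)"
      by (simp add: algebra_simps)
  qed (use zw n that nz0 nzz in auto)
  have "((\<lambda>z. deriv \<phi> w / (\<phi> w - \<phi> z) - 1 / (w - z) - deriv \<phi> w / \<phi> w + 1 / w) has_field_derivative
      deriv \<phi> z * deriv \<phi> w / (\<phi> w - \<phi> z)\<^sup>2 - 1 / (w - z)\<^sup>2) (at z)"
    using zw n nzz[of w z]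
    by (auto intro!: derivative_eq_intros holomorphic_derivI[OF hol] simp: power2_eq_square)
  hence "((\<lambda>z. deriv_snd Q z w) has_field_derivative
      deriv \<phi> z * deriv \<phi> w / (\<phi> w - \<phi> z)\<^sup>2 - 1 / (w - z)\<^sup>2) (at z)"
  proof (rule has_field_derivative_transform_within_open[where S = "unit_disc - {0, w}"])
    show "open (unit_disc - {0, w})" by (intro open_Diff) auto
  qed (use zw n R in auto)
  hence S: "deriv_fst (deriv_snd Q) z w = deriv \<phi> z * deriv \<phi> w / (\<phi> w - \<phi> z)\<^sup>2 - 1 / (w - z)\<^sup>2"
    unfolding deriv_fst_def by (rule DERIV_imp_deriv)
  show ?thesis
    unfolding S P R[OF zw(1) n(1,3)]
    by (rule wave_equation_identity) (use zw n nz0 nzz in auto)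
qed

section \<open>From the wave equation to a univalent function\<close>

lemma wave_equation_imp_grunsky:
  assumes Q: "holomorphic2_on Q (unit_disc \<times> unit_disc)"
    and Q0: "\<And>w. w \<in> unit_disc \<Longrightarrow> Q 0 w = 0" "\<And>z. z \<in> unit_disc \<Longrightarrow> Q z 0 = 0"
    and eq: "\<And>z w. z \<in> unit_disc \<Longrightarrow> w \<in> unit_disc \<Longrightarrow> z * w * (z - w) \<noteq> 0 \<Longrightarrow>
      deriv_fst (deriv_snd Q) z w + deriv_fst Q z w * deriv_snd Q z w
        - (z\<^sup>2 * deriv_fst Q z w - w\<^sup>2 * deriv_snd Q z w) / (z * w * (z - w)) = 0"
  shows "\<exists>\<phi>. normalized_univalent \<phi> \<and>
    (\<forall>z\<in>unit_disc. \<forall>w\<in>unit_disc. Q z w = Q_transform (grunsky \<phi>) z w)"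
proof -
  obtain \<eta> where \<eta>: "\<eta> holomorphic_on unit_disc" "\<eta> 0 = 1"
    and rel: "\<And>z w. z \<in> unit_disc \<Longrightarrow> w \<in> unit_disc \<Longrightarrow> (z - w) * exp (Q z w) = z * \<eta> w - w * \<eta> z"
    using wave_equation_imp_split[OF Q Q0 eq] by blast
  have inj\<eta>: "z = w" if "z \<in> unit_disc" "w \<in> unit_disc" "z * \<eta> w = w * \<eta> z" for z w
    using rel[OF that(1,2)] that(3) by simp
  obtain c where c: "\<And>z. z \<in> unit_disc \<Longrightarrow> \<eta> z + c * z \<noteq> 0"
    using exists_nonvanishing_shift[OF \<eta> inj\<eta>] by blast
  define X where "X = (\<lambda>z. \<eta> z + c * z)"
  have X0: "X z \<noteq> 0" if "z \<in> unit_disc" for z using c[OF that] by (simp add: X_def)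
  \<comment> \<open>The terms c z w cancel, so the shift does not affect exp Q.\<close>
  have Xrel: "z * X w - w * X z = (z - w) * exp (Q z w)" if "z \<in> unit_disc" "w \<in> unit_disc" for z w
    using rel[OF that] by (simp add: X_def algebra_simps)
  have hX: "X holomorphic_on unit_disc" unfolding X_def by (intro holomorphic_intros \<eta>)
  \<comment> \<open>This is 1 / (\<psi> + c) for \<psi> z = \<eta> z / z, with the pole of \<psi> at
    0 cleared; X 0 = 1 yields the normalization.\<close>
  define \<phi> where "\<phi> = (\<lambda>z. z / X z)"
  have \<phi>: "normalized_univalent \<phi>"
    unfolding normalized_univalent_def
  proof (intro conjI)
    show "\<phi> holomorphic_on unit_disc" unfolding \<phi>_def by (intro holomorphic_intros hX X0)
    show "inj_on \<phi> unit_disc"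
    proof (rule inj_onI)
      fix z w assume zw: "z \<in> unit_disc" "w \<in> unit_disc" "\<phi> z = \<phi> w"
      hence "z * X w = w * X z" using X0[of z] X0[of w] by (simp add: \<phi>_def field_simps)
      thus "z = w" using Xrel[OF zw(1,2)] by simp
    qed
    show "\<phi> 0 = 0" by (simp add: \<phi>_def)
    have "X 0 = 1" by (simp add: X_def \<eta>)
    have "(X has_field_derivative deriv X 0) (at 0)" by (rule holomorphic_derivI[OF hX]) auto
    hence "(\<phi> has_field_derivative 1) (at 0)"
      unfolding \<phi>_def using \<open>X 0 = 1\<close> by (auto intro!: derivative_eq_intros)
    thus "deriv \<phi> 0 = 1" by (rule DERIV_imp_deriv)
  qed
  have "Q z w = Q_transform (grunsky \<phi>) z w" if z: "z \<in> unit_disc" and w: "w \<in> unit_disc" for z w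
  proof (cases "z = 0")
    case True
    thus ?thesis using Q0 w by (simp add: Q_transform_def)
  next
    case False
    obtain g where g: "g holomorphic_on unit_disc" "g 0 = 0"
        "\<And>w. w \<in> unit_disc \<Longrightarrow> Q_transform (grunsky \<phi>) z w = g w"
        "\<And>w. w \<in> unit_disc \<Longrightarrow> exp (g w) * ((z - w) * \<phi> z * \<phi> w) = z * w * (\<phi> z - \<phi> w)"
      using Q_transform_grunsky[OF \<phi> z] by blast
    have "Q z w = g w"
    \<comment> \<open>Both exponentials satisfy the same relation, but its factor (z - v) * \<phi> z
      * \<phi> v can be cancelled only for v outside {0, z}. The branches agree at 0 by condition
      (a).\<close>
    proof (rule eq_of_exp_eq[where f = "Q z" and g = g and S = unit_disc and K = "{0, z}" and a = 0])
      show "Q z holomorphic_on unit_disc" using holomorphic2_on_snd[OF Q _ _ z] by simp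
      show "Q z 0 = g 0" using Q0 z g by simp
      fix v assume v: "v \<in> unit_disc - {0, z}"
      have n: "X z \<noteq> 0" "X v \<noteq> 0" using X0 z v by auto
      have "exp (g v) * ((z - v) * (z / X z) * (v / X v)) = z * v * (z / X z - v / X v)"
        using g(4)[of v] v by (simp add: \<phi>_def)
      also have "\<dots> = z * v * (z * X v - v * X z) / (X z * X v)"
        using n by (simp add: field_simps)
      also have "\<dots> = exp (Q z v) * ((z - v) * (z / X z) * (v / X v))"
        using Xrel[of z v] z v by (simp add: mult_ac)
      finally show "exp (Q z v) = exp (g v)" using v n False by auto
    qed (use g w in auto)
    thus ?thesis using g w by simp
  qed
  with \<phi> show ?thesis by blast
qed

theorem theorem1p11p1:
  fixes Q :: "complex \<Rightarrow> complex \<Rightarrow> complex"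
  assumes "holomorphic2_on Q (unit_disc \<times> unit_disc)"
  shows "(\<exists>\<phi>. normalized_univalent \<phi> \<and>
            (\<forall>z\<in>unit_disc. \<forall>w\<in>unit_disc. Q z w = Q_transform (grunsky \<phi>) z w)) \<longleftrightarrow>
         ((\<forall>w\<in>unit_disc. Q 0 w = 0) \<and> (\<forall>z\<in>unit_disc. Q z 0 = 0)) \<and>
         (\<forall>z\<in>unit_disc. \<forall>w\<in>unit_disc. z * w * (z - w) \<noteq> 0 \<longrightarrow>
            deriv_fst (deriv_snd Q) z w + deriv_fst Q z w * deriv_snd Q z w
              - (z\<^sup>2 * deriv_fst Q z w - w\<^sup>2 * deriv_snd Q z w) / (z * w * (z - w)) = 0)"
  (is "?lhs \<longleftrightarrow> ?rhs")
proof
  assume ?lhs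
  then obtain \<phi> where \<phi>: "normalized_univalent \<phi>"
    and QT: "\<And>z w. z \<in> unit_disc \<Longrightarrow> w \<in> unit_disc \<Longrightarrow> Q z w = Q_transform (grunsky \<phi>) z w"
    by blast
  show ?rhs
    using grunsky_imp_wave_equation[OF assms \<phi> QT] QT by (auto simp: Q_transform_def)
next
  assume ?rhs
  thus ?lhs by (intro wave_equation_imp_grunsky assms) auto
qed

end
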